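(* Let $(R,\mathfrak m)$ be a Cohen-Macaulay (commutative Noetherian) local ring of dimension $1$. Let $M$ be a (finitely generated) maximal Cohen-Macaulay $R$-module, and let $I$ be an $\mathfrak m$-primary ideal of $R$. Then $IM\cong M$ as $R$-modules if and only if $M\cong \operatorname{Hom}_R(I,M)$ as $R$-modules.
   Context: In the paper, a maximal Cohen-Macaulay module $M$ satisfying $IM\cong M$ is called $I$-Ulrich. *)

theory Defs
  imports "HOL-Algebra.Algebra" "HOL-Library.Extended_Nat"
begin

section \<open>Modules\<close>

definition ring_as_module :: "('a, 'c) ring_scheme \<Rightarrow> ('a, 'a) module" where
  "ring_as_module R =
     \<lparr>carrier = carrier R, monoid.mult = (\<otimes>\<^bsub>R\<^esub>), one = \<one>\<^bsub>R\<^esub>,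
      ring.zero = \<zero>\<^bsub>R\<^esub>, ring.add = (\<oplus>\<^bsub>R\<^esub>), smult = (\<otimes>\<^bsub>R\<^esub>)\<rparr>"

definition submodule_span ::
    "('a, 'c) ring_scheme \<Rightarrow> ('a, 'b, 'd) module_scheme \<Rightarrow> 'b set \<Rightarrow> 'b set" where
  "submodule_span R M S = \<Inter>{N. submodule N R M \<and> S \<subseteq> N}"

definition finitely_generated_module ::
    "('a, 'c) ring_scheme \<Rightarrow> ('a, 'b, 'd) module_scheme \<Rightarrow> bool" where
  "finitely_generated_module R M \<longleftrightarrow>
     (\<exists>A. finite A \<and> A \<subseteq> carrier M \<and> carrier M = submodule_span R M A)"

text \<open>The underlying set of \<open>I M\<close>; as a module, it is \<open>M\<lparr>carrier := ideal_smult R I M\<rparr>\<close>.\<close>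

definition ideal_smult ::
    "('a, 'c) ring_scheme \<Rightarrow> 'a set \<Rightarrow> ('a, 'b, 'd) module_scheme \<Rightarrow> 'b set" where
  "ideal_smult R I M = submodule_span R M {a \<odot>\<^bsub>M\<^esub> x | a x. a \<in> I \<and> x \<in> carrier M}"

text \<open>Homomorphisms are taken extensional (\<open>undefined\<close> outside the carrier of the domain), so
  that equality of functions is equality on that carrier.\<close>

definition linear_maps ::
    "('a, 'c) ring_scheme \<Rightarrow> ('a, 'b, 'd) module_scheme \<Rightarrow> ('a, 'e, 'f) module_scheme \<Rightarrow> ('b \<Rightarrow> 'e) set" where
  "linear_maps R M N =
     {f \<in> carrier M \<rightarrow>\<^sub>E carrier N.
        (\<forall>x\<in>carrier M. \<forall>y\<in>carrier M. f (x \<oplus>\<^bsub>M\<^esub> y) = f x \<oplus>\<^bsub>N\<^esub> f y) \<and>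
        (\<forall>a\<in>carrier R. \<forall>x\<in>carrier M. f (a \<odot>\<^bsub>M\<^esub> x) = a \<odot>\<^bsub>N\<^esub> f x)}"

text \<open>The ring fields \<open>mult\<close> and \<open>one\<close> of a module record carry no meaning.\<close>

definition Hom_module ::
    "('a, 'c) ring_scheme \<Rightarrow> ('a, 'b, 'd) module_scheme \<Rightarrow> ('a, 'e, 'f) module_scheme \<Rightarrow> ('a, 'b \<Rightarrow> 'e) module" where
  "Hom_module R M N =
     \<lparr>carrier = linear_maps R M N, monoid.mult = undefined, one = undefined,
      ring.zero = (\<lambda>x\<in>carrier M. \<zero>\<^bsub>N\<^esub>),
      ring.add = (\<lambda>f g. \<lambda>x\<in>carrier M. f x \<oplus>\<^bsub>N\<^esub> g x),
      smult = (\<lambda>a f. \<lambda>x\<in>carrier M. a \<odot>\<^bsub>N\<^esub> f x)\<rparr>"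

definition modules_isomorphic ::
    "('a, 'c) ring_scheme \<Rightarrow> ('a, 'b, 'd) module_scheme \<Rightarrow> ('a, 'e, 'f) module_scheme \<Rightarrow> bool" where
  "modules_isomorphic R M N \<longleftrightarrow>
     (\<exists>f\<in>linear_maps R M N. bij_betw f (carrier M) (carrier N))"


section \<open>Local rings, dimension and depth\<close>

definition local_ring :: "('a, 'c) ring_scheme \<Rightarrow> 'a set \<Rightarrow> bool" where
  "local_ring R \<mm> \<longleftrightarrow> cring R \<and> {J. maximalideal J R} = {\<mm>}"

definition krull_dim :: "('a, 'c) ring_scheme \<Rightarrow> enat" where
  "krull_dim R =
     Sup {enat n | n. \<exists>P :: nat \<Rightarrow> 'a set.
            (\<forall>i\<le>n. primeideal (P i) R) \<and> (\<forall>i<n. P i \<subset> P (Suc i))}"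

text \<open>The first condition says that \<open>xs ! i\<close> is a nonzerodivisor on \<open>M / (xs\<^sub>0, \<dots>, xs\<^sub>i\<^sub>-\<^sub>1) M\<close>.\<close>

definition regular_sequence ::
    "('a, 'c) ring_scheme \<Rightarrow> ('a, 'b, 'd) module_scheme \<Rightarrow> 'a list \<Rightarrow> bool" where
  "regular_sequence R M xs \<longleftrightarrow>
     set xs \<subseteq> carrier R \<and>
     (\<forall>i<length xs. \<forall>y\<in>carrier M.
        (xs ! i) \<odot>\<^bsub>M\<^esub> y \<in> ideal_smult R (Idl\<^bsub>R\<^esub> (set (take i xs))) M \<longrightarrow>
        y \<in> ideal_smult R (Idl\<^bsub>R\<^esub> (set (take i xs))) M) \<and>
     ideal_smult R (Idl\<^bsub>R\<^esub> (set xs)) M \<noteq> carrier M"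

definition depth ::
    "('a, 'c) ring_scheme \<Rightarrow> 'a set \<Rightarrow> ('a, 'b, 'd) module_scheme \<Rightarrow> enat" where
  "depth R \<mm> M =
     (if ideal_smult R \<mm> M = carrier M then \<infinity>
      else Sup {enat (length xs) | xs. set xs \<subseteq> \<mm> \<and> regular_sequence R M xs})"

definition cohen_macaulay_local_ring :: "('a, 'c) ring_scheme \<Rightarrow> 'a set \<Rightarrow> bool" where
  "cohen_macaulay_local_ring R \<mm> \<longleftrightarrow>
     noetherian_ring R \<and> local_ring R \<mm> \<and> depth R \<mm> (ring_as_module R) = krull_dim R"

text \<open>The zero module, whose depth is \<open>\<infinity>\<close>, counts as maximal Cohen-Macaulay.\<close>

definition maximal_cohen_macaulay ::
    "('a, 'c) ring_scheme \<Rightarrow> 'a set \<Rightarrow> ('a, 'b, 'd) module_scheme \<Rightarrow> bool" where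
  "maximal_cohen_macaulay R \<mm> M \<longleftrightarrow>
     module R M \<and> finitely_generated_module R M \<and>
     (carrier M = {\<zero>\<^bsub>M\<^esub>} \<or> depth R \<mm> M = krull_dim R)"


section \<open>Primary ideals\<close>

definition radical :: "('a, 'c) ring_scheme \<Rightarrow> 'a set \<Rightarrow> 'a set" where
  "radical R I = {a \<in> carrier R. \<exists>n::nat. a [^]\<^bsub>R\<^esub> n \<in> I}"

definition primary_ideal :: "('a, 'c) ring_scheme \<Rightarrow> 'a set \<Rightarrow> bool" where
  "primary_ideal R I \<longleftrightarrow>
     ideal I R \<and> I \<noteq> carrier R \<and>
     (\<forall>a\<in>carrier R. \<forall>b\<in>carrier R. a \<otimes>\<^bsub>R\<^esub> b \<in> I \<longrightarrow> a \<in> I \<or> b \<in> radical R I)"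

definition primary_to :: "('a, 'c) ring_scheme \<Rightarrow> 'a set \<Rightarrow> 'a set \<Rightarrow> bool" where
  "primary_to R \<pp> I \<longleftrightarrow> primary_ideal R I \<and> radical R I = \<pp>"


section \<open>The constructions are modules\<close>

lemma (in cring) ring_as_module_module: "module R (ring_as_module R)"
proof (rule moduleI)
  show "abelian_group (ring_as_module R)"
    by (rule abelian_groupI)
       (auto simp: ring_as_module_def a_ac intro: bexI[of _ "\<ominus> _"] l_neg)
qed (auto simp: ring_as_module_def l_distr r_distr m_assoc is_cring)

lemma (in module) submodule_span_submodule:
  assumes "S \<subseteq> carrier M"
  shows "submodule (submodule_span R M S) R M"
proof -
  have "\<zero>\<^bsub>M\<^esub> \<in> N" if "submodule N R M" for N
    using subgroup.one_closed[OF submodule.axioms(1)[OF that]] by simp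
  then show ?thesis
    using assms carrier_is_submodule
    by (intro submoduleI) (auto simp: submodule_span_def submoduleE(3,4,5))
qed

lemma (in module) ideal_smult_module:
  assumes "ideal I R"
  shows "module R (M\<lparr>carrier := ideal_smult R I M\<rparr>)"
  unfolding ideal_smult_def
  by (intro submodule.submodule_is_module submodule_span_submodule module_axioms)
     (use ideal.Icarr[OF assms] in auto)

lemma (in cring) ideal_as_module_module:
  assumes "ideal I R"
  shows "module R ((ring_as_module R)\<lparr>carrier := I\<rparr>)"
proof -
  interpret I: ideal I R by fact
  interpret S: module R "ring_as_module R" by (rule ring_as_module_module)
  have "\<ominus>\<^bsub>ring_as_module R\<^esub> a = \<ominus> a" for a
    by (simp add: a_inv_def m_inv_def ring_as_module_def)
  then have "submodule I R (ring_as_module R)"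
    by (intro S.submoduleI)
       (auto simp: ring_as_module_def I.I_l_closed dest: I.Icarr)
  then show ?thesis
    by (rule submodule.submodule_is_module) (rule ring_as_module_module)
qed

lemma Hom_module_module:
  assumes "module R M" "module R N"
  shows "module R (Hom_module R M N)"
proof -
  interpret M: module R M by fact
  interpret N: module R N by fact
  show ?thesis
  proof (rule moduleI)
    show "abelian_group (Hom_module R M N)"
    proof (rule abelian_groupI)
      fix f assume f: "f \<in> carrier (Hom_module R M N)"
      show "\<exists>g\<in>carrier (Hom_module R M N). g \<oplus>\<^bsub>Hom_module R M N\<^esub> f = \<zero>\<^bsub>Hom_module R M N\<^esub>"
        using f
        by (intro bexI[of _ "\<lambda>x\<in>carrier M. \<ominus>\<^bsub>N\<^esub> f x"])
           (auto simp: Hom_module_def linear_maps_def PiE_iff N.smult_r_minus N.minus_add N.l_neg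
                 intro!: restrict_ext)
    qed (auto simp: Hom_module_def linear_maps_def PiE_iff N.a_ac N.smult_r_distr
              intro!: restrict_ext extensionalityI[of _ "carrier M"])
  qed (auto simp: Hom_module_def linear_maps_def PiE_iff N.a_ac N.smult_r_distr N.smult_l_distr
          N.smult_assoc1[symmetric] M.R.m_comm M.R.is_cring
        intro!: restrict_ext extensionalityI[of _ "carrier M"])
qed

end

theory Submission
  imports Defs
begin

text \<open>
  Let \<open>c \<in> I\<close> be \<open>M\<close>-regular. Evaluation at \<open>c\<close> identifies \<open>Hom(I, M)\<close> with
  \<open>C = {y \<in> M. I y \<subseteq> c M}\<close>, so the two conditions say that some injective endomorphism \<open>\<phi>\<close> of \<open>M\<close>
  has image \<open>I M\<close>, respectively that some injective endomorphism \<open>\<theta>\<close> has image \<open>C\<close>. The two are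
  exchanged by \<open>\<phi> \<theta> = \<theta> \<phi> = c\<close>: the endomorphisms \<open>h\<^sub>a = \<phi>\<^sup>-\<^sup>1 a\<close> (\<open>a \<in> I\<close>), among them \<open>h\<^sub>c = \<theta>\<close>, lie
  in the bicommutant of \<open>\<phi>\<close>, which is a commutative ring; \<open>\<phi> M = I M\<close> says that the \<open>h\<^sub>a M\<close>
  generate \<open>M\<close>, and \<open>\<theta> M = C\<close> says that no nonzero element of \<open>M / \<theta> M\<close> is killed by all \<open>h\<^sub>a\<close>. In
  dimension one \<open>M / \<theta> M\<close>, a quotient of \<open>M / c M\<close>, has finite length; and for a module \<open>V\<close> of finite
  length over a commutative ring and an ideal \<open>J\<close>, both \<open>J V = V\<close> and \<open>(0 :\<^sub>V J) = 0\<close> are equivalent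
  to some element of \<open>1 + J\<close> killing \<open>V\<close>, as one sees from a minimal \<open>N \<subseteq> V\<close> such that \<open>u V \<subseteq> N\<close>
  for some \<open>u \<in> 1 + J\<close>, respectively a maximal \<open>N\<close> such that \<open>u N = 0\<close>.
\<close>

section \<open>Submodules and linear maps\<close>

lemma (in module) submodule_zero:
  assumes "submodule N R M"
  shows "\<zero>\<^bsub>M\<^esub> \<in> N"
  using subgroup.one_closed[OF submodule.axioms(1)[OF assms]] by simp

lemma (in module) submodule_minus:
  assumes "submodule N R M" "x \<in> N" "y \<in> N"
  shows "x \<ominus>\<^bsub>M\<^esub> y \<in> N"
  using assms by (simp add: a_minus_def submoduleE(3,5)[OF assms(1)])

lemma (in module) submodule_Int:
  assumes "submodule N R M" "submodule N' R M"
  shows "submodule (N \<inter> N') R M"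
  using assms submoduleE(1)[OF assms(1)]
  by (intro submoduleI) (auto simp: submodule_zero submoduleE(3-5))

lemma set_addI:
  assumes "x \<in> A" "y \<in> B"
  shows "x \<oplus>\<^bsub>G\<^esub> y \<in> A <+>\<^bsub>G\<^esub> B"
  using assms unfolding set_add_def' by blast

lemma (in module) submodule_set_add:
  assumes N: "submodule N R M" and N': "submodule N' R M"
  shows "submodule (N <+>\<^bsub>M\<^esub> N') R M"
proof (rule submodule.intro)
  show "subgroup (N <+>\<^bsub>M\<^esub> N') (add_monoid M)"
    unfolding set_add_def by (rule M.add.mult_subgroups[OF submodule.axioms(1)[OF N] submodule.axioms(1)[OF N']])
  show "submodule_axioms (N <+>\<^bsub>M\<^esub> N') R M"
  proof
    fix a x assume a: "a \<in> carrier R" and "x \<in> N <+>\<^bsub>M\<^esub> N'"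
    then obtain y z where yz: "y \<in> N" "z \<in> N'" "x = y \<oplus>\<^bsub>M\<^esub> z" by (auto simp: set_add_def')
    then have "a \<odot>\<^bsub>M\<^esub> x = a \<odot>\<^bsub>M\<^esub> y \<oplus>\<^bsub>M\<^esub> a \<odot>\<^bsub>M\<^esub> z"
      using a submoduleE(1)[OF N] submoduleE(1)[OF N'] by (auto intro: smult_r_distr)
    then show "a \<odot>\<^bsub>M\<^esub> x \<in> N <+>\<^bsub>M\<^esub> N'"
      using a yz submoduleE(4)[OF N] submoduleE(4)[OF N'] by (simp add: set_addI)
  qed
qed

lemma (in module) submodule_set_add_upper:
  assumes N: "submodule N R M" and N': "submodule N' R M"
  shows "N \<subseteq> N <+>\<^bsub>M\<^esub> N'" and "N' \<subseteq> N <+>\<^bsub>M\<^esub> N'"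
  using submodule_zero[OF N] submodule_zero[OF N'] submoduleE(1)[OF N] submoduleE(1)[OF N']
  by (force simp: set_add_def')+

lemma (in module) submodule_set_add_least:
  assumes "submodule U R M" "N \<subseteq> U" "N' \<subseteq> U"
  shows "N <+>\<^bsub>M\<^esub> N' \<subseteq> U"
  using assms submoduleE(5)[OF assms(1)] by (auto simp: set_add_def')

lemma (in module) ideal_smult_submodule:
  assumes "S \<subseteq> carrier R"
  shows "submodule (ideal_smult R S M) R M"
  unfolding ideal_smult_def by (rule submodule_span_submodule) (use assms in auto)

lemma ideal_smultI:
  assumes "a \<in> S" "x \<in> carrier M"
  shows "a \<odot>\<^bsub>M\<^esub> x \<in> ideal_smult R S M"
  using assms unfolding ideal_smult_def submodule_span_def by blast

lemma ideal_smult_least: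
  assumes "submodule N R M" "\<And>a x. a \<in> S \<Longrightarrow> x \<in> carrier M \<Longrightarrow> a \<odot>\<^bsub>M\<^esub> x \<in> N"
  shows "ideal_smult R S M \<subseteq> N"
  using assms unfolding ideal_smult_def submodule_span_def by blast

definition residual_ideal ::
    "('a, 'c) ring_scheme \<Rightarrow> ('a, 'b, 'd) module_scheme \<Rightarrow> 'b set \<Rightarrow> 'b set \<Rightarrow> 'a set" where
  "residual_ideal R M N A = {r \<in> carrier R. \<forall>x\<in>A. r \<odot>\<^bsub>M\<^esub> x \<in> N}"

lemma (in module) residual_ideal_ideal:
  assumes N: "submodule N R M" and A: "A \<subseteq> carrier M"
  shows "ideal (residual_ideal R M N A) R"
proof (rule idealI)
  show "subgroup (residual_ideal R M N A) (add_monoid R)"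
    using A submodule_zero[OF N] submoduleE(3,5)[OF N]
    by (intro R.add.subgroupI)
      (auto simp: residual_ideal_def subset_iff smult_l_minus smult_l_distr intro: exI[of _ \<zero>])
  fix r t assume r: "r \<in> residual_ideal R M N A" and t: "t \<in> carrier R"
  then show "t \<otimes> r \<in> residual_ideal R M N A"
    using A submoduleE(4)[OF N] by (auto simp: residual_ideal_def subset_iff smult_assoc1)
  with r t show "r \<otimes> t \<in> residual_ideal R M N A"
    by (simp add: residual_ideal_def R.m_comm)
qed (rule R.ring_axioms)

definition residual_submodule :: "('a, 'b, 'd) module_scheme \<Rightarrow> 'b set \<Rightarrow> 'a set \<Rightarrow> 'b set" where
  "residual_submodule M N S = {x \<in> carrier M. \<forall>a\<in>S. a \<odot>\<^bsub>M\<^esub> x \<in> N}"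

lemma (in module) smult_left_commute:
  assumes "a \<in> carrier R" "b \<in> carrier R" "x \<in> carrier M"
  shows "a \<odot>\<^bsub>M\<^esub> (b \<odot>\<^bsub>M\<^esub> x) = b \<odot>\<^bsub>M\<^esub> (a \<odot>\<^bsub>M\<^esub> x)"
  using assms by (simp add: smult_assoc1[symmetric] R.m_comm)

lemma (in module) residual_submodule_submodule:
  assumes N: "submodule N R M" and S: "S \<subseteq> carrier R"
  shows "submodule (residual_submodule M N S) R M"
  using S submodule_zero[OF N] submoduleE(3-5)[OF N]
  by (intro submoduleI)
    (auto simp: residual_submodule_def subset_iff smult_r_minus smult_r_distr smult_left_commute[of _ a for a])

lemma linear_mapsI:
  assumes "\<And>x. x \<in> carrier M \<Longrightarrow> f x \<in> carrier N"
    and "\<And>x y. x \<in> carrier M \<Longrightarrow> y \<in> carrier M \<Longrightarrow> f (x \<oplus>\<^bsub>M\<^esub> y) = f x \<oplus>\<^bsub>N\<^esub> f y"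
    and "\<And>a x. a \<in> carrier R \<Longrightarrow> x \<in> carrier M \<Longrightarrow> f (a \<odot>\<^bsub>M\<^esub> x) = a \<odot>\<^bsub>N\<^esub> f x"
    and "f \<in> extensional (carrier M)"
  shows "f \<in> linear_maps R M N"
  using assms by (simp add: linear_maps_def PiE_def)

lemma
  assumes "f \<in> linear_maps R M N"
  shows linear_maps_closed: "x \<in> carrier M \<Longrightarrow> f x \<in> carrier N"
    and linear_maps_add: "x \<in> carrier M \<Longrightarrow> y \<in> carrier M \<Longrightarrow> f (x \<oplus>\<^bsub>M\<^esub> y) = f x \<oplus>\<^bsub>N\<^esub> f y"
    and linear_maps_smult: "a \<in> carrier R \<Longrightarrow> x \<in> carrier M \<Longrightarrow> f (a \<odot>\<^bsub>M\<^esub> x) = a \<odot>\<^bsub>N\<^esub> f x"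
    and linear_maps_extensional: "f \<in> extensional (carrier M)"
  using assms by (auto simp: linear_maps_def PiE_def)

lemma linear_maps_ext:
  assumes "f \<in> linear_maps R M N" "g \<in> linear_maps R M N" "\<And>x. x \<in> carrier M \<Longrightarrow> f x = g x"
  shows "f = g"
  using linear_maps_extensional[OF assms(1)] linear_maps_extensional[OF assms(2)] assms(3)
  by (rule extensionalityI)

lemma
  assumes M: "module R M" and N: "module R N" and f: "f \<in> linear_maps R M N"
  shows linear_maps_zero: "f \<zero>\<^bsub>M\<^esub> = \<zero>\<^bsub>N\<^esub>"
    and linear_maps_uminus: "x \<in> carrier M \<Longrightarrow> f (\<ominus>\<^bsub>M\<^esub> x) = \<ominus>\<^bsub>N\<^esub> f x"
proof -
  interpret M: module R M by fact
  interpret N: module R N by fact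
  note closed = linear_maps_closed[OF f]
  show "f \<zero>\<^bsub>M\<^esub> = \<zero>\<^bsub>N\<^esub>"
    using linear_maps_smult[OF f, of "\<zero>\<^bsub>R\<^esub>" "\<zero>\<^bsub>M\<^esub>"] closed[of "\<zero>\<^bsub>M\<^esub>"] by simp
  show "f (\<ominus>\<^bsub>M\<^esub> x) = \<ominus>\<^bsub>N\<^esub> f x" if "x \<in> carrier M"
    using linear_maps_smult[OF f, of "\<ominus>\<^bsub>R\<^esub> \<one>\<^bsub>R\<^esub>" x] closed[OF that] that
    by (simp add: M.smult_l_minus N.smult_l_minus)
qed

lemma linear_maps_compose:
  assumes "f \<in> linear_maps R M N" "g \<in> linear_maps R N P" "module R M"
  shows "compose (carrier M) g f \<in> linear_maps R M P"
proof -
  interpret module R M by fact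
  show ?thesis
    using assms(1,2)
    by (intro linear_mapsI)
      (auto simp: compose_eq linear_maps_closed linear_maps_add linear_maps_smult)
qed

lemma linear_map_image_submodule:
  assumes M: "module R M" and N: "module R N" and f: "f \<in> linear_maps R M N" and U: "submodule U R M"
  shows "submodule (f ` U) R N"
proof -
  interpret M: module R M by fact
  interpret N: module R N by fact
  note carr = subsetD[OF M.submoduleE(1)[OF U]]
  show ?thesis
  proof (rule N.submoduleI)
    show "\<zero>\<^bsub>N\<^esub> \<in> f ` U"
      using M.submodule_zero[OF U] linear_maps_zero[OF M N f] by (metis imageI)
  qed (use carr M.submoduleE(3-5)[OF U] linear_maps_closed[OF f] in
      \<open>auto simp: linear_maps_uminus[OF M N f, symmetric] linear_maps_add[OF f, symmetric]
        linear_maps_smult[OF f, symmetric]\<close>)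
qed

lemma linear_map_vimage_submodule:
  assumes M: "module R M" and N: "module R N" and f: "f \<in> linear_maps R M N" and U: "submodule U R N"
  shows "submodule {x \<in> carrier M. f x \<in> U} R M"
proof -
  interpret M: module R M by fact
  interpret N: module R N by fact
  show ?thesis
    using N.submoduleE(3-5)[OF U] N.submodule_zero[OF U]
    by (intro M.submoduleI)
      (auto simp: linear_maps_zero[OF M N f] linear_maps_uminus[OF M N f] linear_maps_add[OF f]
        linear_maps_smult[OF f])
qed

lemma (in module) linear_map_ideal_smult:
  assumes f: "f \<in> linear_maps R M M" and S: "S \<subseteq> carrier R" and x: "x \<in> ideal_smult R S M"
  shows "f x \<in> ideal_smult R S M"
proof -
  have "ideal_smult R S M \<subseteq> {x \<in> carrier M. f x \<in> ideal_smult R S M}"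
    using S linear_maps_closed[OF f] linear_maps_smult[OF f]
    by (intro ideal_smult_least linear_map_vimage_submodule[OF module_axioms module_axioms f]
        ideal_smult_submodule) (auto simp: subset_iff ideal_smultI)
  with x show ?thesis by blast
qed

lemma linear_map_lift:
  assumes M: "module R M" and P: "module R P"
    and f: "f \<in> linear_maps R M N" "inj_on f (carrier M)"
    and g: "g \<in> linear_maps R P N" "g ` carrier P \<subseteq> f ` carrier M"
  obtains h where "h \<in> linear_maps R P M" "\<And>x. x \<in> carrier P \<Longrightarrow> f (h x) = g x"
proof
  interpret M: module R M by fact
  interpret P: module R P by fact
  define h where "h = (\<lambda>x\<in>carrier P. inv_into (carrier M) f (g x))"
  have closed: "h x \<in> carrier M" if "x \<in> carrier P" for x
    using g(2) that by (simp add: h_def image_subset_iff inv_into_into)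
  show fh: "f (h x) = g x" if "x \<in> carrier P" for x
    using g(2) that by (simp add: h_def image_subset_iff f_inv_into_f)
  show "h \<in> linear_maps R P M"
  proof (rule linear_mapsI)
    fix x y assume "x \<in> carrier P" "y \<in> carrier P"
    then show "h (x \<oplus>\<^bsub>P\<^esub> y) = h x \<oplus>\<^bsub>M\<^esub> h y"
      by (intro inj_onD[OF f(2)]) (simp_all add: fh closed linear_maps_add[OF f(1)] linear_maps_add[OF g(1)])
  next
    fix a x assume "a \<in> carrier R" "x \<in> carrier P"
    then show "h (a \<odot>\<^bsub>P\<^esub> x) = a \<odot>\<^bsub>M\<^esub> h x"
      by (intro inj_onD[OF f(2)])
        (simp_all add: fh closed linear_maps_smult[OF f(1)] linear_maps_smult[OF g(1)])
  qed (simp_all add: closed, simp add: h_def)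
qed

lemma (in module) smult_linear:
  assumes "c \<in> carrier R"
  shows "(\<lambda>x\<in>carrier M. c \<odot>\<^bsub>M\<^esub> x) \<in> linear_maps R M M"
  using assms by (intro linear_mapsI) (auto simp: smult_r_distr smult_left_commute)

lemma (in module) smult_image_submodule:
  assumes "c \<in> carrier R"
  shows "submodule ((\<odot>\<^bsub>M\<^esub>) c ` carrier M) R M"
  using linear_map_image_submodule[OF module_axioms module_axioms smult_linear[OF assms]
      carrier_is_submodule]
  by simp

lemma (in module) smult_vimage_submodule:
  assumes "c \<in> carrier R" "submodule N R M"
  shows "submodule {x \<in> carrier M. c \<odot>\<^bsub>M\<^esub> x \<in> N} R M"
  using linear_map_vimage_submodule[OF module_axioms module_axioms smult_linear[OF assms(1)] assms(2)]
  by (simp cong: conj_cong)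

lemma (in module) smult_element_linear:
  assumes "ideal I R" "y \<in> carrier M"
  shows "(\<lambda>a\<in>I. a \<odot>\<^bsub>M\<^esub> y) \<in> linear_maps R ((ring_as_module R)\<lparr>carrier := I\<rparr>) M"
proof -
  interpret I: ideal I R by fact
  show ?thesis
    using assms(2)
    by (intro linear_mapsI)
      (auto simp: ring_as_module_def smult_l_distr smult_assoc1 I.Icarr I.I_l_closed)
qed

definition cyclic_submodule ::
    "('a, 'c) ring_scheme \<Rightarrow> ('a, 'b, 'd) module_scheme \<Rightarrow> 'b \<Rightarrow> 'b set" where
  "cyclic_submodule R M e = (\<lambda>r. r \<odot>\<^bsub>M\<^esub> e) ` carrier R"

lemma (in module) cyclic_submodule_submodule:
  assumes "e \<in> carrier M"
  shows "submodule (cyclic_submodule R M e) R M"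
proof -
  let ?R = "(ring_as_module R)\<lparr>carrier := carrier R\<rparr>"
  have "module R ?R" by (rule R.ideal_as_module_module[OF R.oneideal])
  then have "submodule ((\<lambda>a\<in>carrier R. a \<odot>\<^bsub>M\<^esub> e) ` carrier ?R) R M"
    by (rule linear_map_image_submodule[OF _ module_axioms smult_element_linear[OF R.oneideal assms]
          module.carrier_is_submodule]) fact
  then show ?thesis by (simp add: cyclic_submodule_def)
qed

lemma (in module) cyclic_submodule_self:
  assumes "e \<in> carrier M"
  shows "e \<in> cyclic_submodule R M e"
  unfolding cyclic_submodule_def using assms by (intro image_eqI[of _ _ \<one>]) simp_all

lemma (in module) cyclic_submodule_least:
  assumes "submodule N R M" "e \<in> N"
  shows "cyclic_submodule R M e \<subseteq> N"
  using assms submoduleE(4)[OF assms(1)] by (auto simp: cyclic_submodule_def)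

section \<open>Finite length\<close>

definition submodules_between ::
    "('a, 'c) ring_scheme \<Rightarrow> ('a, 'b, 'd) module_scheme \<Rightarrow> 'b set \<Rightarrow> 'b set \<Rightarrow> 'b set set" where
  "submodules_between R M K L = {U. submodule U R M \<and> K \<subseteq> U \<and> U \<subseteq> L}"

text \<open>A strictly monotone \<open>len\<close> bounds the chains of submodules between \<open>K\<close> and \<open>L\<close>, which is
  what finite length of \<open>L / K\<close> means; \<open>len\<close> need not be the additive length.\<close>

definition finite_length ::
    "('a, 'c) ring_scheme \<Rightarrow> ('a, 'b, 'd) module_scheme \<Rightarrow> 'b set \<Rightarrow> 'b set \<Rightarrow> bool" where
  "finite_length R M K L \<longleftrightarrow>
     (\<exists>len :: 'b set \<Rightarrow> nat. strict_mono_on (submodules_between R M K L) len)"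

lemma finite_length_subset:
  assumes "finite_length R M K L" "submodules_between R' M' K' L' \<subseteq> submodules_between R M K L"
  shows "finite_length R' M' K' L'"
  using assms unfolding finite_length_def by (blast intro: monotone_on_subset)

lemma finite_length_mono:
  assumes "finite_length R M K L" "K \<subseteq> K'" "L' \<subseteq> L"
  shows "finite_length R M K' L'"
  by (rule finite_length_subset[OF assms(1)]) (use assms(2,3) in \<open>auto simp: submodules_between_def\<close>)

lemma finite_length_minimal:
  assumes "finite_length R M K L" "F \<subseteq> submodules_between R M K L" "F \<noteq> {}"
  obtains N where "N \<in> F" "\<And>N'. N' \<in> F \<Longrightarrow> N' \<subseteq> N \<Longrightarrow> N' = N"
proof -
  obtain len :: "_ \<Rightarrow> nat" where len: "strict_mono_on F len"
    using assms(1,2) unfolding finite_length_def by (blast intro: monotone_on_subset)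
  obtain N where N: "N \<in> F" "\<And>N'. N' \<in> F \<Longrightarrow> len N \<le> len N'"
    using assms(3) ex_has_least_nat[of "\<lambda>N. N \<in> F" _ len] by blast
  show thesis
  proof (rule that)
    show "N' = N" if "N' \<in> F" "N' \<subseteq> N" for N'
      using N strict_mono_onD[OF len that(1) N(1)] that by (fastforce simp: not_less[symmetric])
  qed (rule N(1))
qed

lemma finite_length_maximal:
  assumes "finite_length R M K L" "submodule L R M" "F \<subseteq> submodules_between R M K L" "F \<noteq> {}"
  obtains N where "N \<in> F" "\<And>N'. N' \<in> F \<Longrightarrow> N \<subseteq> N' \<Longrightarrow> N' = N"
proof -
  obtain len :: "_ \<Rightarrow> nat" where len: "strict_mono_on (submodules_between R M K L) len"
    using assms(1) unfolding finite_length_def by blast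
  have bound: "len N < Suc (len L)" if "N \<in> F" for N
  proof (cases "N = L")
    case False
    have "N \<in> submodules_between R M K L" using assms(3) that by blast
    moreover from this have "L \<in> submodules_between R M K L" "N \<subset> L"
      using assms(2) False by (auto simp: submodules_between_def)
    ultimately show ?thesis using strict_mono_onD[OF len] less_SucI by blast
  qed simp
  obtain N where N: "N \<in> F" "\<And>N'. N' \<in> F \<Longrightarrow> len N' \<le> len N"
    using assms(4) bound ex_has_greatest_nat[of "\<lambda>N. N \<in> F" _ len "Suc (len L)"] by blast
  show thesis
  proof (rule that)
    show "N' = N" if "N' \<in> F" "N \<subseteq> N'" for N'
      using N assms(3) strict_mono_onD[OF len, of N N'] that
      by (fastforce simp: not_less[symmetric])
  qed (rule N(1))
qed

lemma ex_simple_quotient: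
  assumes "finite_length R M L N" "submodule L R M" "submodule N R M" "L \<subset> N"
  obtains N' where "submodule N' R M" "L \<subseteq> N'" "N' \<subset> N" "submodules_between R M N' N = {N', N}"
proof -
  define F where "F = submodules_between R M L N - {N}"
  have "F \<subseteq> submodules_between R M L N" "F \<noteq> {}"
    using assms(2,4) by (auto simp: F_def submodules_between_def)
  then obtain N' where N': "N' \<in> F" and max: "\<And>U. U \<in> F \<Longrightarrow> N' \<subseteq> U \<Longrightarrow> U = N'"
    using finite_length_maximal[OF assms(1,3)] by metis
  show thesis
  proof (rule that)
    show sub: "submodule N' R M" "L \<subseteq> N'" "N' \<subset> N"
      using N' by (auto simp: F_def submodules_between_def)
    show "submodules_between R M N' N = {N', N}"
      using max sub assms(3) by (auto simp: F_def submodules_between_def)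
  qed
qed

lemma ex_simple_submodule:
  assumes "finite_length R M N L" "submodule L R M" "submodule N R M" "N \<subset> L"
  obtains N' where "submodule N' R M" "N \<subset> N'" "N' \<subseteq> L" "submodules_between R M N N' = {N, N'}"
proof -
  define F where "F = submodules_between R M N L - {N}"
  have "F \<subseteq> submodules_between R M N L" "F \<noteq> {}"
    using assms(2,4) by (auto simp: F_def submodules_between_def)
  then obtain N' where N': "N' \<in> F" and min: "\<And>U. U \<in> F \<Longrightarrow> U \<subseteq> N' \<Longrightarrow> U = N'"
    using finite_length_minimal[OF assms(1)] by metis
  show thesis
  proof (rule that)
    show sub: "submodule N' R M" "N \<subset> N'" "N' \<subseteq> L"
      using N' by (auto simp: F_def submodules_between_def)
    show "submodules_between R M N N' = {N, N'}"
      using min sub assms(3) unfolding F_def submodules_between_def by blast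
  qed
qed

lemma finite_length_if_simple:
  assumes "submodules_between R M K L \<subseteq> {K, L}"
  shows "finite_length R M K L"
proof -
  have "strict_mono_on (submodules_between R M K L) (\<lambda>U. if U = K then 0 else 1 :: nat)"
    using assms by (intro strict_mono_onI) (auto simp: submodules_between_def)
  then show ?thesis unfolding finite_length_def by blast
qed

lemma finite_length_refl: "finite_length R M K K"
  by (rule finite_length_if_simple) (auto simp: submodules_between_def)

lemma (in module) submodule_modular_cancel:
  assumes U: "submodule U R M" and V: "submodule V R M" and L: "L \<subseteq> carrier M" and "U \<subseteq> V"
    and "U \<inter> L = V \<inter> L" and "U <+>\<^bsub>M\<^esub> L = V <+>\<^bsub>M\<^esub> L" and "\<zero>\<^bsub>M\<^esub> \<in> L"
  shows "U = V"
proof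
  show "V \<subseteq> U"
  proof
    fix v assume v: "v \<in> V"
    have carr: "v \<in> carrier M" using v submoduleE(1)[OF V] by blast
    have "v \<oplus>\<^bsub>M\<^esub> \<zero>\<^bsub>M\<^esub> \<in> V <+>\<^bsub>M\<^esub> L" using v assms(7) by (rule set_addI)
    then have "v \<in> U <+>\<^bsub>M\<^esub> L" using carr assms(6) by simp
    then obtain u l where ul: "u \<in> U" "l \<in> L" "v = u \<oplus>\<^bsub>M\<^esub> l" by (auto simp: set_add_def')
    have carr: "u \<in> carrier M" "l \<in> carrier M" using ul submoduleE(1)[OF U] L by blast+
    have "l = v \<ominus>\<^bsub>M\<^esub> u" using carr ul(3) by (simp add: a_minus_def M.a_ac M.r_neg M.r_neg1 M.r_neg2)
    then have "l \<in> V \<inter> L" using v ul assms(4) submodule_minus[OF V] by blast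
    then show "v \<in> U" using ul assms(5) submoduleE(5)[OF U] by blast
  qed
qed (rule assms(4))

lemma (in module) finite_length_trans:
  assumes KL: "finite_length R M K L" and LQ: "finite_length R M L Q"
    and L: "submodule L R M" and Q: "submodule Q R M" and "K \<subseteq> L" "L \<subseteq> Q"
  shows "finite_length R M K Q"
proof -
  obtain len len' :: "_ \<Rightarrow> nat" where len: "strict_mono_on (submodules_between R M K L) len"
    and len': "strict_mono_on (submodules_between R M L Q) len'"
    using KL LQ unfolding finite_length_def by blast
  have "strict_mono_on (submodules_between R M K Q) (\<lambda>U. len (U \<inter> L) + len' (U <+>\<^bsub>M\<^esub> L))"
  proof (rule strict_mono_onI)
    fix U V assume UV: "U \<in> submodules_between R M K Q" "V \<in> submodules_between R M K Q" "U \<subset> V"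
    have meet: "W \<inter> L \<in> submodules_between R M K L" if "W \<in> submodules_between R M K Q" for W
      using that submodule_Int[OF _ L] assms(5) by (auto simp: submodules_between_def)
    have join: "W <+>\<^bsub>M\<^esub> L \<in> submodules_between R M L Q" if "W \<in> submodules_between R M K Q" for W
      using that submodule_set_add[OF _ L] submodule_set_add_upper(2)[OF _ L]
        submodule_set_add_least[OF Q _ assms(6)] by (simp add: submodules_between_def)
    have le: "U \<inter> L \<subseteq> V \<inter> L" "U <+>\<^bsub>M\<^esub> L \<subseteq> V <+>\<^bsub>M\<^esub> L"
      using UV(3) by (auto simp: set_add_def')
    then have "len (U \<inter> L) \<le> len (V \<inter> L)" "len' (U <+>\<^bsub>M\<^esub> L) \<le> len' (V <+>\<^bsub>M\<^esub> L)"
      using strict_mono_on_leD[OF len meet meet] strict_mono_on_leD[OF len' join join] UV(1,2) by auto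
    moreover have "U \<inter> L \<subset> V \<inter> L \<or> U <+>\<^bsub>M\<^esub> L \<subset> V <+>\<^bsub>M\<^esub> L"
      using le submodule_modular_cancel[of U V L] UV submoduleE(1)[OF L] submodule_zero[OF L]
      by (auto simp: submodules_between_def)
    ultimately show "len (U \<inter> L) + len' (U <+>\<^bsub>M\<^esub> L) < len (V \<inter> L) + len' (V <+>\<^bsub>M\<^esub> L)"
      using strict_mono_onD[OF len meet meet] strict_mono_onD[OF len' join join] UV(1,2)
      by (meson add_le_less_mono add_less_le_mono)
  qed
  then show ?thesis unfolding finite_length_def by blast
qed

section \<open>Commutative rings acting on a module of finite length\<close>

text \<open>For finitely generated \<open>N / N'\<close> this says that its localization at \<open>1 + J\<close> vanishes.\<close>

definition killed_by_one_plus ::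
    "('a, 'c) ring_scheme \<Rightarrow> ('a, 'b, 'd) module_scheme \<Rightarrow> 'a set \<Rightarrow> 'b set \<Rightarrow> 'b set \<Rightarrow> bool" where
  "killed_by_one_plus R M J N N' \<longleftrightarrow>
     (\<exists>u\<in>carrier R. \<one>\<^bsub>R\<^esub> \<ominus>\<^bsub>R\<^esub> u \<in> J \<and> (\<forall>x\<in>N. u \<odot>\<^bsub>M\<^esub> x \<in> N'))"

lemma (in module) killed_by_one_plus_refl:
  assumes "ideal J R" "N \<subseteq> carrier M"
  shows "killed_by_one_plus R M J N N"
proof -
  have "\<zero> \<in> J" by (rule additive_subgroup.zero_closed[OF ideal.axioms(1)[OF assms(1)]])
  then show ?thesis
    using assms(2) unfolding killed_by_one_plus_def
    by (intro bexI[of _ \<one>]) (auto simp: a_minus_def R.r_neg)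
qed

lemma (in module) killed_by_one_plus_trans:
  assumes J: "ideal J R" and N: "N \<subseteq> carrier M"
    and "killed_by_one_plus R M J N N'" "killed_by_one_plus R M J N' N''"
  shows "killed_by_one_plus R M J N N''"
proof -
  interpret J: ideal J R by fact
  obtain u v where u: "u \<in> carrier R" "\<one> \<ominus> u \<in> J" "\<And>x. x \<in> N \<Longrightarrow> u \<odot>\<^bsub>M\<^esub> x \<in> N'"
    and v: "v \<in> carrier R" "\<one> \<ominus> v \<in> J" "\<And>x. x \<in> N' \<Longrightarrow> v \<odot>\<^bsub>M\<^esub> x \<in> N''"
    using assms(3,4) unfolding killed_by_one_plus_def by blast
  have "\<one> \<ominus> v \<otimes> u = (\<one> \<ominus> v) \<oplus> v \<otimes> (\<one> \<ominus> u)" using u(1) v(1) by algebra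
  then have "\<one> \<ominus> v \<otimes> u \<in> J" using u(2) v(1,2) by (simp add: J.I_l_closed)
  then show ?thesis
    using u v N unfolding killed_by_one_plus_def
    by (intro bexI[of _ "v \<otimes> u"]) (auto simp: smult_assoc1 subset_iff)
qed

lemma (in module) ex_one_minus_smult_mem:
  assumes J: "ideal J R" "a \<in> J" and N: "submodule N R M" and x: "x \<in> carrier M"
    and mem: "x \<in> N <+>\<^bsub>M\<^esub> cyclic_submodule R M (a \<odot>\<^bsub>M\<^esub> x)"
  shows "\<exists>u\<in>carrier R. \<one> \<ominus> u \<in> J \<and> u \<odot>\<^bsub>M\<^esub> x \<in> N"
proof -
  interpret J: ideal J R by fact
  have a: "a \<in> carrier R" using J(2) by (rule J.Icarr)
  obtain n b where nb: "n \<in> N" "b \<in> carrier R" "x = n \<oplus>\<^bsub>M\<^esub> b \<odot>\<^bsub>M\<^esub> (a \<odot>\<^bsub>M\<^esub> x)"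
    using mem unfolding set_add_def' cyclic_submodule_def by blast
  have "\<one> \<ominus> (\<one> \<ominus> b \<otimes> a) = b \<otimes> a" using nb(2) a by algebra
  then have "\<one> \<ominus> (\<one> \<ominus> b \<otimes> a) \<in> J" using J.I_l_closed[OF J(2) nb(2)] by simp
  moreover have "(\<one> \<ominus> b \<otimes> a) \<odot>\<^bsub>M\<^esub> x = x \<ominus>\<^bsub>M\<^esub> b \<odot>\<^bsub>M\<^esub> (a \<odot>\<^bsub>M\<^esub> x)"
    using nb(2) a x by (simp add: a_minus_def smult_l_distr smult_l_minus smult_assoc1)
  moreover have "x \<ominus>\<^bsub>M\<^esub> b \<odot>\<^bsub>M\<^esub> (a \<odot>\<^bsub>M\<^esub> x) = n"
    using nb a x submoduleE(1)[OF N] M.add.inv_solve_right'[of n x "b \<odot>\<^bsub>M\<^esub> (a \<odot>\<^bsub>M\<^esub> x)"]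
    by (auto simp: a_minus_def a_inv_def)
  ultimately show ?thesis using nb(1,2) a by (intro bexI[of _ "\<one> \<ominus> b \<otimes> a"]) simp_all
qed

lemma (in module) simple_quotient_killed_by_one_plus:
  assumes J: "ideal J R" and N': "submodule N' R M" and N: "submodule N R M"
    and simple: "submodules_between R M N' N = {N', N}"
    and a: "a \<in> J" and x: "x \<in> N" and ax: "a \<odot>\<^bsub>M\<^esub> x \<notin> N'"
  shows "killed_by_one_plus R M J N N'"
proof -
  have N'N: "N' \<subseteq> N" using simple by (auto simp: submodules_between_def)
  have aR: "a \<in> carrier R" using ideal.Icarr[OF J a] .
  have xM: "x \<in> carrier M" using x submoduleE(1)[OF N] by blast
  have axM: "a \<odot>\<^bsub>M\<^esub> x \<in> carrier M" using aR xM by simp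
  have axN: "a \<odot>\<^bsub>M\<^esub> x \<in> N" using aR x by (rule submoduleE(4)[OF N])
  let ?E = "cyclic_submodule R M (a \<odot>\<^bsub>M\<^esub> x)"
  note E = cyclic_submodule_submodule[OF axM] cyclic_submodule_self[OF axM] cyclic_submodule_least[OF N axN]
  have "N' <+>\<^bsub>M\<^esub> ?E \<in> submodules_between R M N' N"
    using submodule_set_add[OF N' E(1)] submodule_set_add_upper(1)[OF N' E(1)]
      submodule_set_add_least[OF N N'N E(3)]
    by (simp add: submodules_between_def)
  then have "N' <+>\<^bsub>M\<^esub> ?E = N"
    using simple submodule_set_add_upper(2)[OF N' E(1)] E(2) ax by auto
  then obtain u where u: "u \<in> carrier R" "\<one> \<ominus> u \<in> J" "u \<odot>\<^bsub>M\<^esub> x \<in> N'"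
    using ex_one_minus_smult_mem[OF J a N' xM] x by blast
  define P where "P = {y \<in> carrier M. u \<odot>\<^bsub>M\<^esub> y \<in> N'}"
  have "P \<inter> N \<in> submodules_between R M N' N"
    using submodule_Int[OF smult_vimage_submodule[OF u(1) N'] N] N'N submoduleE(1,4)[OF N'] u(1)
    by (auto simp: submodules_between_def P_def)
  moreover have "x \<in> P \<inter> N" using x xM u(3) by (simp add: P_def)
  moreover have "x \<notin> N'" using submoduleE(4)[OF N' aR] ax by blast
  ultimately have "P \<inter> N = N" unfolding simple by auto
  then have "\<forall>y\<in>N. u \<odot>\<^bsub>M\<^esub> y \<in> N'" by (auto simp: P_def)
  with u show ?thesis unfolding killed_by_one_plus_def by blast
qed

lemma (in module) killed_by_one_plus_into_simple_quotient:
  assumes S: "S \<subseteq> carrier R" and L: "L \<subseteq> N'" and N': "submodule N' R M" and N: "submodule N R M"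
    and simple: "submodules_between R M N' N = {N', N}"
    and surj: "ideal_smult R S M <+>\<^bsub>M\<^esub> L = carrier M"
    and killed: "killed_by_one_plus R M (Idl S) (carrier M) N"
  shows "killed_by_one_plus R M (Idl S) (carrier M) N'"
proof (cases "\<forall>s\<in>S. \<forall>x\<in>N. s \<odot>\<^bsub>M\<^esub> x \<in> N'")
  case True
  obtain u where u: "u \<in> carrier R" "\<one> \<ominus> u \<in> Idl S" "\<And>x. x \<in> carrier M \<Longrightarrow> u \<odot>\<^bsub>M\<^esub> x \<in> N"
    using killed unfolding killed_by_one_plus_def by blast
  define P where "P = {y \<in> carrier M. u \<odot>\<^bsub>M\<^esub> y \<in> N'}"
  have P: "submodule P R M" unfolding P_def by (rule smult_vimage_submodule[OF u(1) N'])
  have "u \<odot>\<^bsub>M\<^esub> (s \<odot>\<^bsub>M\<^esub> x) \<in> N'" if "s \<in> S" "x \<in> carrier M" for s x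
    using True that u(1,3) S by (auto simp: smult_left_commute[of u s])
  then have "ideal_smult R S M \<subseteq> P" using S by (intro ideal_smult_least P) (auto simp: P_def)
  moreover have "L \<subseteq> P" using L submoduleE(1,4)[OF N'] u(1) by (auto simp: P_def)
  ultimately have "carrier M \<subseteq> P" using submodule_set_add_least[OF P] surj by metis
  then show ?thesis using u(1,2) unfolding killed_by_one_plus_def P_def by blast
next
  case False
  then obtain s x where "s \<in> S" and x: "x \<in> N" "s \<odot>\<^bsub>M\<^esub> x \<notin> N'" by blast
  then have "s \<in> Idl S" using R.genideal_self[OF S] by blast
  then have "killed_by_one_plus R M (Idl S) N N'"
    by (rule simple_quotient_killed_by_one_plus[OF R.genideal_ideal[OF S] N' N simple _ x])
  then show ?thesis by (rule killed_by_one_plus_trans[OF R.genideal_ideal[OF S] subset_refl killed])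
qed

lemma (in module) simple_extension_killed_by_one_plus:
  assumes S: "S \<subseteq> carrier R" and N: "submodule N R M" and N': "submodule N' R M"
    and simple: "submodules_between R M N N' = {N, N'}"
    and inj: "residual_submodule M L S \<subseteq> L"
    and killed: "killed_by_one_plus R M (Idl S) N L"
  shows "killed_by_one_plus R M (Idl S) N' L"
proof (cases "\<forall>s\<in>S. \<forall>x\<in>N'. s \<odot>\<^bsub>M\<^esub> x \<in> N")
  case True
  obtain u where u: "u \<in> carrier R" "\<one> \<ominus> u \<in> Idl S" "\<And>x. x \<in> N \<Longrightarrow> u \<odot>\<^bsub>M\<^esub> x \<in> L"
    using killed unfolding killed_by_one_plus_def by blast
  have "u \<odot>\<^bsub>M\<^esub> x \<in> L" if x: "x \<in> N'" for x
  proof -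
    have xM: "x \<in> carrier M" using x submoduleE(1)[OF N'] by blast
    have "s \<odot>\<^bsub>M\<^esub> (u \<odot>\<^bsub>M\<^esub> x) \<in> L" if "s \<in> S" for s
      using True that u(1,3) x xM S by (auto simp: smult_left_commute[of s u])
    then show ?thesis using inj xM u(1) by (auto simp: residual_submodule_def)
  qed
  then show ?thesis using u(1,2) unfolding killed_by_one_plus_def by blast
next
  case False
  then obtain s x where "s \<in> S" and x: "x \<in> N'" "s \<odot>\<^bsub>M\<^esub> x \<notin> N" by blast
  then have "s \<in> Idl S" using R.genideal_self[OF S] by blast
  then have "killed_by_one_plus R M (Idl S) N' N"
    by (rule simple_quotient_killed_by_one_plus[OF R.genideal_ideal[OF S] N N' simple _ x])
  then show ?thesis
    using killed by (rule killed_by_one_plus_trans[OF R.genideal_ideal[OF S] submoduleE(1)[OF N']])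
qed

lemma (in module) killed_by_one_plus_if_smult_surjective:
  assumes fin: "finite_length R M L (carrier M)" and L: "submodule L R M" and S: "S \<subseteq> carrier R"
    and surj: "ideal_smult R S M <+>\<^bsub>M\<^esub> L = carrier M"
  shows "killed_by_one_plus R M (Idl S) (carrier M) L"
proof -
  define F where "F = {N \<in> submodules_between R M L (carrier M).
    killed_by_one_plus R M (Idl S) (carrier M) N}"
  have "carrier M \<in> F"
    using submoduleE(1)[OF L] carrier_is_submodule
      killed_by_one_plus_refl[OF R.genideal_ideal[OF S] subset_refl]
    by (auto simp: F_def submodules_between_def)
  moreover have "F \<subseteq> submodules_between R M L (carrier M)" by (auto simp: F_def)
  ultimately obtain N where N: "N \<in> F" and min: "\<And>N'. N' \<in> F \<Longrightarrow> N' \<subseteq> N \<Longrightarrow> N' = N"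
    using finite_length_minimal[OF fin] by (metis empty_iff)
  then have NM: "submodule N R M" "L \<subseteq> N" "N \<subseteq> carrier M"
    and killed: "killed_by_one_plus R M (Idl S) (carrier M) N"
    by (auto simp: F_def submodules_between_def)
  have "N = L"
  proof (rule ccontr)
    assume "N \<noteq> L"
    then obtain N' where N': "submodule N' R M" "L \<subseteq> N'" "N' \<subset> N"
      and simple: "submodules_between R M N' N = {N', N}"
      using ex_simple_quotient[OF finite_length_mono[OF fin subset_refl NM(3)] L NM(1)] NM(2)
      by blast
    have "N' \<in> F"
      using killed_by_one_plus_into_simple_quotient[OF S N'(2,1) NM(1) simple surj killed] N' NM(3)
      by (auto simp: F_def submodules_between_def)
    with min N'(3) show False by blast
  qed
  with killed show ?thesis by simp
qed

lemma (in module) killed_by_one_plus_if_smult_injective: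
  assumes fin: "finite_length R M L (carrier M)" and L: "submodule L R M" and S: "S \<subseteq> carrier R"
    and inj: "residual_submodule M L S \<subseteq> L"
  shows "killed_by_one_plus R M (Idl S) (carrier M) L"
proof -
  define F where "F = {N \<in> submodules_between R M L (carrier M). killed_by_one_plus R M (Idl S) N L}"
  have "L \<in> F"
    using L submoduleE(1)[OF L] killed_by_one_plus_refl[OF R.genideal_ideal[OF S]]
    by (auto simp: F_def submodules_between_def)
  moreover have "F \<subseteq> submodules_between R M L (carrier M)" by (auto simp: F_def)
  ultimately obtain N where N: "N \<in> F" and max: "\<And>N'. N' \<in> F \<Longrightarrow> N \<subseteq> N' \<Longrightarrow> N' = N"
    using finite_length_maximal[OF fin carrier_is_submodule] by (metis empty_iff)
  then have NM: "submodule N R M" "L \<subseteq> N" "N \<subseteq> carrier M"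
    and killed: "killed_by_one_plus R M (Idl S) N L"
    by (auto simp: F_def submodules_between_def)
  have "N = carrier M"
  proof (rule ccontr)
    assume "N \<noteq> carrier M"
    then obtain N' where N': "submodule N' R M" "N \<subset> N'" "N' \<subseteq> carrier M"
      and simple: "submodules_between R M N N' = {N, N'}"
      using ex_simple_submodule[OF finite_length_mono[OF fin NM(2) subset_refl] carrier_is_submodule NM(1)]
        NM(3) by blast
    have "N' \<in> F"
      using simple_extension_killed_by_one_plus[OF S NM(1) N'(1) simple inj killed] N' NM(2)
      by (auto simp: F_def submodules_between_def)
    with max N'(2) show False by blast
  qed
  with killed show ?thesis by simp
qed

theorem (in module) smult_surjective_iff_injective:
  assumes fin: "finite_length R M L (carrier M)" and L: "submodule L R M" and S: "S \<subseteq> carrier R"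
  shows "ideal_smult R S M <+>\<^bsub>M\<^esub> L = carrier M \<longleftrightarrow> residual_submodule M L S \<subseteq> L"
proof -
  have SM: "submodule (ideal_smult R S M) R M" by (rule ideal_smult_submodule[OF S])
  have split: "x = (\<one> \<ominus> u) \<odot>\<^bsub>M\<^esub> x \<oplus>\<^bsub>M\<^esub> u \<odot>\<^bsub>M\<^esub> x" if "u \<in> carrier R" "x \<in> carrier M" for u x
    using that by (simp add: a_minus_def smult_l_distr[symmetric] R.a_assoc R.l_neg)
  show ?thesis
  proof
    assume "ideal_smult R S M <+>\<^bsub>M\<^esub> L = carrier M"
    then obtain u where u: "u \<in> carrier R" "\<one> \<ominus> u \<in> Idl S" "\<And>x. x \<in> carrier M \<Longrightarrow> u \<odot>\<^bsub>M\<^esub> x \<in> L"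
      using killed_by_one_plus_if_smult_surjective[OF assms] unfolding killed_by_one_plus_def by blast
    show "residual_submodule M L S \<subseteq> L"
    proof
      fix x assume x: "x \<in> residual_submodule M L S"
      then have xM: "x \<in> carrier M" by (simp add: residual_submodule_def)
      have "Idl S \<subseteq> residual_ideal R M L {x}"
        using x S xM by (intro R.genideal_minimal residual_ideal_ideal L)
          (auto simp: residual_ideal_def residual_submodule_def)
      then have "(\<one> \<ominus> u) \<odot>\<^bsub>M\<^esub> x \<in> L" using u(2) by (auto simp: residual_ideal_def)
      then show "x \<in> L" using split[OF u(1) xM] submoduleE(5)[OF L] u(3)[OF xM] by metis
    qed
  next
    assume "residual_submodule M L S \<subseteq> L"
    then obtain u where u: "u \<in> carrier R" "\<one> \<ominus> u \<in> Idl S" "\<And>x. x \<in> carrier M \<Longrightarrow> u \<odot>\<^bsub>M\<^esub> x \<in> L"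
      using killed_by_one_plus_if_smult_injective[OF assms] unfolding killed_by_one_plus_def by blast
    have "Idl S \<subseteq> residual_ideal R M (ideal_smult R S M) (carrier M)"
      using S by (intro R.genideal_minimal residual_ideal_ideal SM)
        (auto simp: residual_ideal_def ideal_smultI)
    then have "(\<one> \<ominus> u) \<odot>\<^bsub>M\<^esub> x \<in> ideal_smult R S M" if "x \<in> carrier M" for x
      using u(2) that by (auto simp: residual_ideal_def)
    then have "carrier M \<subseteq> ideal_smult R S M <+>\<^bsub>M\<^esub> L"
      using split[OF u(1)] u(3) set_addI by (metis subsetI)
    then show "ideal_smult R S M <+>\<^bsub>M\<^esub> L = carrier M"
      using submoduleE(1)[OF submodule_set_add[OF SM L]] by blast
  qed
qed

section \<open>Endomorphism rings\<close>

definition endomorphism_ring ::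
    "('a, 'c) ring_scheme \<Rightarrow> ('a, 'b, 'd) module_scheme \<Rightarrow> ('a, 'b \<Rightarrow> 'b) module" where
  "endomorphism_ring R M =
     (Hom_module R M M)\<lparr>monoid.mult := compose (carrier M), one := \<lambda>x\<in>carrier M. x\<rparr>"

lemma endomorphism_ring_simps:
  "carrier (endomorphism_ring R M) = linear_maps R M M"
  "f \<otimes>\<^bsub>endomorphism_ring R M\<^esub> g = compose (carrier M) f g"
  "\<one>\<^bsub>endomorphism_ring R M\<^esub> = (\<lambda>x\<in>carrier M. x)"
  "\<zero>\<^bsub>endomorphism_ring R M\<^esub> = (\<lambda>x\<in>carrier M. \<zero>\<^bsub>M\<^esub>)"
  "f \<oplus>\<^bsub>endomorphism_ring R M\<^esub> g = (\<lambda>x\<in>carrier M. f x \<oplus>\<^bsub>M\<^esub> g x)"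
  by (simp_all add: endomorphism_ring_def Hom_module_def)

lemma (in module) endomorphism_ring_ring: "ring (endomorphism_ring R M)"
proof -
  let ?E = "endomorphism_ring R M"
  interpret H: module R "Hom_module R M M" by (rule Hom_module_module[OF module_axioms module_axioms])
  have "abelian_group ?E"
    using H.abelian_group_axioms
    by (simp add: endomorphism_ring_def abelian_group_def abelian_group_axioms_def abelian_monoid_def)
  moreover have "monoid ?E"
  proof (rule monoidI)
    fix f g h assume "f \<in> carrier ?E" "g \<in> carrier ?E" "h \<in> carrier ?E"
    then show "f \<otimes>\<^bsub>?E\<^esub> g \<in> carrier ?E"
      by (simp add: endomorphism_ring_simps linear_maps_compose module_axioms)
    show "f \<otimes>\<^bsub>?E\<^esub> g \<otimes>\<^bsub>?E\<^esub> h = f \<otimes>\<^bsub>?E\<^esub> (g \<otimes>\<^bsub>?E\<^esub> h)"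
      using \<open>h \<in> carrier ?E\<close>
      by (auto simp: endomorphism_ring_simps compose_def linear_maps_closed)
  next
    show "\<one>\<^bsub>?E\<^esub> \<in> carrier ?E" by (auto simp: endomorphism_ring_simps intro!: linear_mapsI)
    fix f assume "f \<in> carrier ?E"
    then have "f \<in> carrier M \<rightarrow> carrier M" "f \<in> extensional (carrier M)"
      by (auto simp: endomorphism_ring_simps linear_maps_closed linear_maps_extensional)
    then show "\<one>\<^bsub>?E\<^esub> \<otimes>\<^bsub>?E\<^esub> f = f" and "f \<otimes>\<^bsub>?E\<^esub> \<one>\<^bsub>?E\<^esub> = f"
      by (simp_all add: endomorphism_ring_simps Id_compose compose_Id)
  qed
  ultimately show ?thesis
  proof (rule ringI)
    fix f g h assume "f \<in> carrier ?E" "g \<in> carrier ?E" "h \<in> carrier ?E"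
    then show "(f \<oplus>\<^bsub>?E\<^esub> g) \<otimes>\<^bsub>?E\<^esub> h = f \<otimes>\<^bsub>?E\<^esub> h \<oplus>\<^bsub>?E\<^esub> g \<otimes>\<^bsub>?E\<^esub> h"
      and "h \<otimes>\<^bsub>?E\<^esub> (f \<oplus>\<^bsub>?E\<^esub> g) = h \<otimes>\<^bsub>?E\<^esub> f \<oplus>\<^bsub>?E\<^esub> h \<otimes>\<^bsub>?E\<^esub> g"
      by (auto simp: endomorphism_ring_simps compose_def linear_maps_closed linear_maps_add
          restrict_def fun_eq_iff)
  qed
qed

definition centralizer :: "('a, 'c) ring_scheme \<Rightarrow> 'a set \<Rightarrow> 'a set" where
  "centralizer R S = {x \<in> carrier R. \<forall>s\<in>S. x \<otimes>\<^bsub>R\<^esub> s = s \<otimes>\<^bsub>R\<^esub> x}"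

lemma (in ring) centralizer_subring:
  assumes "S \<subseteq> carrier R"
  shows "subring (centralizer R S) R"
proof (rule subringI)
  have carr: "s \<in> carrier R" if "s \<in> S" for s using that assms by blast
  fix x y assume "x \<in> centralizer R S" "y \<in> centralizer R S"
  then show "x \<otimes> y \<in> centralizer R S" "x \<oplus> y \<in> centralizer R S" "\<ominus> x \<in> centralizer R S"
    using carr by (auto simp: centralizer_def m_assoc l_distr r_distr l_minus r_minus) (metis m_assoc)
qed (use assms in \<open>auto simp: centralizer_def\<close>)

lemma (in ring) bicentralizer_subcring:
  assumes "x \<in> carrier R"
  shows "subcring (centralizer R (centralizer R {x})) R"
proof (rule subcringI)
  show "subring (centralizer R (centralizer R {x})) R"
    by (rule centralizer_subring) (auto simp: centralizer_def)
  fix y z assume yz: "y \<in> centralizer R (centralizer R {x})" "z \<in> centralizer R (centralizer R {x})"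
  have "x \<in> centralizer R {x}" using assms by (simp add: centralizer_def)
  then have "z \<otimes> x = x \<otimes> z" using yz(2) unfolding centralizer_def by blast
  then have "z \<in> centralizer R {x}" using yz(2) unfolding centralizer_def by blast
  then show "y \<otimes> z = z \<otimes> y" using yz(1) unfolding centralizer_def by blast
qed

definition evaluation_module :: "('a, 'b, 'd) module_scheme \<Rightarrow> ('b \<Rightarrow> 'b, 'b) module" where
  "evaluation_module M =
     \<lparr>carrier = carrier M, monoid.mult = undefined, one = undefined,
      ring.zero = \<zero>\<^bsub>M\<^esub>, ring.add = (\<oplus>\<^bsub>M\<^esub>), smult = (\<lambda>f x. f x)\<rparr>"

lemma evaluation_module_simps [simp]:
  "carrier (evaluation_module M) = carrier M"
  "\<zero>\<^bsub>evaluation_module M\<^esub> = \<zero>\<^bsub>M\<^esub>"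
  "x \<oplus>\<^bsub>evaluation_module M\<^esub> y = x \<oplus>\<^bsub>M\<^esub> y"
  "f \<odot>\<^bsub>evaluation_module M\<^esub> x = f x"
  by (simp_all add: evaluation_module_def)

lemma (in module) evaluation_module_module:
  assumes "subcring A (endomorphism_ring R M)"
  shows "module ((endomorphism_ring R M)\<lparr>carrier := A\<rparr>) (evaluation_module M)"
proof (rule moduleI)
  have A: "A \<subseteq> linear_maps R M M"
    using subcringE(1)[OF assms] by (simp add: endomorphism_ring_simps)
  show "cring ((endomorphism_ring R M)\<lparr>carrier := A\<rparr>)"
    using ring.subcring_iff[OF endomorphism_ring_ring subcringE(1)[OF assms]] assms by simp
  show "abelian_group (evaluation_module M)"
    by (rule abelian_groupI) (auto simp: M.a_ac intro: bexI[of _ "\<ominus>\<^bsub>M\<^esub> _"] M.l_neg)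
  fix f x y assume "f \<in> carrier ((endomorphism_ring R M)\<lparr>carrier := A\<rparr>)"
    and "x \<in> carrier (evaluation_module M)" "y \<in> carrier (evaluation_module M)"
  then show "f \<odot>\<^bsub>evaluation_module M\<^esub> x \<in> carrier (evaluation_module M)"
    and "f \<odot>\<^bsub>evaluation_module M\<^esub> (x \<oplus>\<^bsub>evaluation_module M\<^esub> y) =
      f \<odot>\<^bsub>evaluation_module M\<^esub> x \<oplus>\<^bsub>evaluation_module M\<^esub> f \<odot>\<^bsub>evaluation_module M\<^esub> y"
    using A by (auto simp: linear_maps_closed linear_maps_add)
qed (simp_all add: endomorphism_ring_simps compose_eq)

lemma (in module) submodule_evaluation_moduleD:
  assumes A: "subcring A (endomorphism_ring R M)"
    and scalars: "\<And>a. a \<in> carrier R \<Longrightarrow> (\<lambda>x\<in>carrier M. a \<odot>\<^bsub>M\<^esub> x) \<in> A"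
    and U: "submodule U ((endomorphism_ring R M)\<lparr>carrier := A\<rparr>) (evaluation_module M)"
  shows "submodule U R M"
proof -
  interpret V: module "(endomorphism_ring R M)\<lparr>carrier := A\<rparr>" "evaluation_module M"
    by (rule evaluation_module_module[OF A])
  have carr: "U \<subseteq> carrier M" using V.submoduleE(1)[OF U] by simp
  have smult: "a \<odot>\<^bsub>M\<^esub> x \<in> U" if "a \<in> carrier R" "x \<in> U" for a x
    using V.submoduleE(4)[OF U, of "\<lambda>x\<in>carrier M. a \<odot>\<^bsub>M\<^esub> x" x] scalars that carr by auto
  show ?thesis
  proof (rule submoduleI)
    show "\<ominus>\<^bsub>M\<^esub> x \<in> U" if "x \<in> U" for x
      using smult[of "\<ominus> \<one>" x] that carr by (auto simp: smult_l_minus)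
  qed (use V.submodule_zero[OF U] V.submoduleE(5)[OF U] carr smult in auto)
qed

lemma (in module) submodule_evaluation_moduleI:
  assumes A: "subcring A (endomorphism_ring R M)" and U: "submodule U R M"
    and stable: "\<And>f x. f \<in> A \<Longrightarrow> x \<in> U \<Longrightarrow> f x \<in> U"
  shows "submodule U ((endomorphism_ring R M)\<lparr>carrier := A\<rparr>) (evaluation_module M)"
proof -
  let ?A = "(endomorphism_ring R M)\<lparr>carrier := A\<rparr>"
  interpret V: module ?A "evaluation_module M" by (rule evaluation_module_module[OF A])
  show ?thesis
  proof (rule V.submoduleI)
    fix x assume x: "x \<in> U"
    have minus_one: "\<ominus>\<^bsub>?A\<^esub> \<one>\<^bsub>?A\<^esub> \<in> A" using V.R.a_inv_closed[OF V.R.one_closed] by simp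
    have xV: "x \<in> carrier (evaluation_module M)" using x submoduleE(1)[OF U] by auto
    have "\<ominus>\<^bsub>evaluation_module M\<^esub> x = (\<ominus>\<^bsub>?A\<^esub> \<one>\<^bsub>?A\<^esub>) \<odot>\<^bsub>evaluation_module M\<^esub> x"
      by (simp only: V.smult_l_minus[OF V.R.one_closed xV] V.smult_one[OF xV])
    then show "\<ominus>\<^bsub>evaluation_module M\<^esub> x \<in> U" using stable[OF minus_one x] by simp
  qed (use submoduleE(1,5)[OF U] submodule_zero[OF U] stable in auto)
qed

lemma (in module) scalar_in_centralizer:
  assumes "a \<in> carrier R" "T \<subseteq> linear_maps R M M"
  shows "(\<lambda>x\<in>carrier M. a \<odot>\<^bsub>M\<^esub> x) \<in> centralizer (endomorphism_ring R M) T"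
proof -
  have "compose (carrier M) (\<lambda>x\<in>carrier M. a \<odot>\<^bsub>M\<^esub> x) f = compose (carrier M) f (\<lambda>x\<in>carrier M. a \<odot>\<^bsub>M\<^esub> x)"
    if "f \<in> T" for f
  proof -
    have f: "f \<in> linear_maps R M M" using that assms(2) by blast
    show ?thesis
      using assms(1) linear_maps_closed[OF f] linear_maps_smult[OF f] by (auto simp: compose_def)
  qed
  then show ?thesis
    using smult_linear[OF assms(1)] by (simp add: centralizer_def endomorphism_ring_simps)
qed

section \<open>Factorizations of a regular scalar\<close>

locale scalar_factorization = module R M
  for R :: "('a, 'c) ring_scheme" (structure) and M :: "('a, 'b, 'd) module_scheme" (structure) +
  fixes I :: "'a set" and c :: 'a and \<phi> \<theta> :: "'b \<Rightarrow> 'b"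
  assumes I_ideal: "ideal I R" and c_mem: "c \<in> I"
    and regular: "inj_on ((\<odot>\<^bsub>M\<^esub>) c) (carrier M)"
    and \<phi>_linear: "\<phi> \<in> linear_maps R M M" and \<theta>_linear: "\<theta> \<in> linear_maps R M M"
    and \<phi>_\<theta>: "x \<in> carrier M \<Longrightarrow> \<phi> (\<theta> x) = c \<odot>\<^bsub>M\<^esub> x"
    and \<theta>_\<phi>: "x \<in> carrier M \<Longrightarrow> \<theta> (\<phi> x) = c \<odot>\<^bsub>M\<^esub> x"
begin

abbreviation cM :: "'b set" where
  "cM \<equiv> (\<odot>\<^bsub>M\<^esub>) c ` carrier M"

abbreviation bicommutant :: "('b \<Rightarrow> 'b) set" where
  "bicommutant \<equiv> centralizer (endomorphism_ring R M) (centralizer (endomorphism_ring R M) {\<phi>})"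

lemma I_carrier: "I \<subseteq> carrier R"
  using ideal.Icarr[OF I_ideal] by blast

lemma inj_\<phi>: "inj_on \<phi> (carrier M)"
  using regular \<theta>_\<phi> by (metis (mono_tags, lifting) inj_on_def)

lemma inj_\<theta>: "inj_on \<theta> (carrier M)"
  using regular \<phi>_\<theta> by (metis (mono_tags, lifting) inj_on_def)

lemmas \<phi>_simps = linear_maps_closed[OF \<phi>_linear] linear_maps_smult[OF \<phi>_linear]
lemmas \<theta>_simps = linear_maps_closed[OF \<theta>_linear] linear_maps_smult[OF \<theta>_linear]

lemma \<phi>_eq_iff: "x \<in> carrier M \<Longrightarrow> y \<in> carrier M \<Longrightarrow> \<phi> x = \<phi> y \<longleftrightarrow> x = y"
  using inj_\<phi> by (auto dest: inj_onD)

lemma ideal_smult_le_image_iff: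
  "ideal_smult R I M \<subseteq> \<phi> ` carrier M \<longleftrightarrow> \<theta> ` carrier M \<subseteq> residual_submodule M cM I"
proof
  assume le: "ideal_smult R I M \<subseteq> \<phi> ` carrier M"
  show "\<theta> ` carrier M \<subseteq> residual_submodule M cM I"
  proof clarify
    fix x assume x: "x \<in> carrier M"
    have "a \<odot>\<^bsub>M\<^esub> \<theta> x \<in> cM" if a: "a \<in> I" for a
    proof -
      obtain y where "y \<in> carrier M" "a \<odot>\<^bsub>M\<^esub> x = \<phi> y"
        using le ideal_smultI[OF a x] by blast
      then have "a \<odot>\<^bsub>M\<^esub> \<theta> x = c \<odot>\<^bsub>M\<^esub> y"
        using a x I_carrier \<theta>_simps(2)[of a x] \<theta>_\<phi> by auto
      then show ?thesis using \<open>y \<in> carrier M\<close> by blast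
    qed
    then show "\<theta> x \<in> residual_submodule M cM I"
      using \<theta>_simps(1)[OF x] by (simp add: residual_submodule_def)
  qed
next
  assume le: "\<theta> ` carrier M \<subseteq> residual_submodule M cM I"
  show "ideal_smult R I M \<subseteq> \<phi> ` carrier M"
  proof (rule ideal_smult_least)
    show "submodule (\<phi> ` carrier M) R M"
      by (rule linear_map_image_submodule[OF module_axioms module_axioms \<phi>_linear carrier_is_submodule])
    fix a x assume ax: "a \<in> I" "x \<in> carrier M"
    then have "a \<odot>\<^bsub>M\<^esub> \<theta> x \<in> cM" using le by (auto simp: residual_submodule_def)
    then obtain y where y: "y \<in> carrier M" "a \<odot>\<^bsub>M\<^esub> \<theta> x = c \<odot>\<^bsub>M\<^esub> y" by blast
    have aR: "a \<in> carrier R" using ax(1) I_carrier by blast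
    have "\<theta> (a \<odot>\<^bsub>M\<^esub> x) = \<theta> (\<phi> y)" using y ax aR by (simp add: \<theta>_simps \<theta>_\<phi>)
    then have "a \<odot>\<^bsub>M\<^esub> x = \<phi> y"
      by (rule inj_onD[OF inj_\<theta>]) (use ax aR y \<phi>_simps in auto)
    then show "a \<odot>\<^bsub>M\<^esub> x \<in> \<phi> ` carrier M" using y(1) by blast
  qed
qed

lemma bicommutant_subcring: "subcring bicommutant (endomorphism_ring R M)"
  using ring.bicentralizer_subcring[OF endomorphism_ring_ring] \<phi>_linear
  by (simp add: endomorphism_ring_simps)

lemma scalar_in_bicommutant:
  assumes "a \<in> carrier R"
  shows "(\<lambda>x\<in>carrier M. a \<odot>\<^bsub>M\<^esub> x) \<in> bicommutant"
  using assms by (rule scalar_in_centralizer) (auto simp: centralizer_def endomorphism_ring_simps)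

lemma bicommutant_linear: "f \<in> bicommutant \<Longrightarrow> f \<in> linear_maps R M M"
  by (simp add: centralizer_def endomorphism_ring_simps)

lemma bicommutant_commutes:
  assumes "f \<in> bicommutant" "x \<in> carrier M"
  shows "\<phi> (f x) = f (\<phi> x)"
proof -
  have "\<phi> \<in> centralizer (endomorphism_ring R M) {\<phi>}"
    using \<phi>_linear by (simp add: centralizer_def endomorphism_ring_simps)
  then have "compose (carrier M) f \<phi> = compose (carrier M) \<phi> f"
    using assms(1) by (simp add: centralizer_def endomorphism_ring_simps)
  then show ?thesis using assms(2) by (metis compose_eq)
qed

lemma scalar_quotient_in_bicommutant:
  assumes h: "h \<in> linear_maps R M M" and a: "a \<in> carrier R"
    and \<phi>h: "\<And>x. x \<in> carrier M \<Longrightarrow> \<phi> (h x) = a \<odot>\<^bsub>M\<^esub> x"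
  shows "h \<in> bicommutant"
proof -
  have "compose (carrier M) h f = compose (carrier M) f h"
    if f: "f \<in> centralizer (endomorphism_ring R M) {\<phi>}" for f
  proof -
    have lin: "f \<in> linear_maps R M M" and "compose (carrier M) f \<phi> = compose (carrier M) \<phi> f"
      using f by (simp_all add: centralizer_def endomorphism_ring_simps)
    then have comm: "f (\<phi> x) = \<phi> (f x)" if "x \<in> carrier M" for x
      using that by (metis compose_eq)
    note closed = linear_maps_closed[OF h] linear_maps_closed[OF lin]
    have "h (f x) = f (h x)" if x: "x \<in> carrier M" for x
    proof -
      have "\<phi> (h (f x)) = f (a \<odot>\<^bsub>M\<^esub> x)" using x a closed by (simp add: \<phi>h linear_maps_smult[OF lin])
      also have "\<dots> = \<phi> (f (h x))" using x closed by (simp add: \<phi>h[symmetric] comm)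
      finally show ?thesis using x closed by (simp add: \<phi>_eq_iff)
    qed
    then show ?thesis by (auto simp: compose_def)
  qed
  then show ?thesis using h by (simp add: centralizer_def endomorphism_ring_simps)
qed

end

locale scalar_quotients = scalar_factorization R M I c \<phi> \<theta>
  for R :: "('a, 'c) ring_scheme" (structure) and M :: "('a, 'b, 'd) module_scheme" (structure)
    and I c \<phi> \<theta> +
  fixes h :: "'a \<Rightarrow> 'b \<Rightarrow> 'b"
  assumes h_mem: "a \<in> I \<Longrightarrow> h a \<in> bicommutant"
    and \<phi>_h: "a \<in> I \<Longrightarrow> x \<in> carrier M \<Longrightarrow> \<phi> (h a x) = a \<odot>\<^bsub>M\<^esub> x"
begin

abbreviation A :: "('a, 'b \<Rightarrow> 'b) module" where
  "A \<equiv> (endomorphism_ring R M)\<lparr>carrier := bicommutant\<rparr>"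

abbreviation V :: "('b \<Rightarrow> 'b, 'b) module" where
  "V \<equiv> evaluation_module M"

sublocale V: module A V
  by (rule evaluation_module_module[OF bicommutant_subcring])

lemma h_closed:
  assumes "a \<in> I" "x \<in> carrier M"
  shows "h a x \<in> carrier M"
  using linear_maps_closed[OF bicommutant_linear[OF h_mem]] assms by blast

lemma h_c_eq:
  assumes "x \<in> carrier M"
  shows "h c x = \<theta> x"
  using assms \<phi>_\<theta> \<phi>_h c_mem h_closed \<theta>_simps(1) \<phi>_eq_iff by metis

lemma submodule_if_submodule_over_A: "submodule U A V \<Longrightarrow> submodule U R M"
  by (rule submodule_evaluation_moduleD[OF bicommutant_subcring scalar_in_bicommutant])

lemma image_\<theta>_submodule: "submodule (\<theta> ` carrier M) A V"
proof -
  have "submodule (h c ` carrier M) A V"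
    using V.smult_image_submodule[of "h c"] h_mem[OF c_mem] by (simp add: evaluation_module_def)
  then show ?thesis by (simp add: h_c_eq cong: image_cong)
qed

lemma span_h_submodule: "submodule (ideal_smult A (h ` I) V) A V"
  using h_mem by (intro V.ideal_smult_submodule) auto

lemma h_in_span:
  assumes "a \<in> I" "x \<in> carrier M"
  shows "h a x \<in> ideal_smult A (h ` I) V"
  using ideal_smultI[of "h a" "h ` I" x V A] assms by simp

lemma span_h_add_image_\<theta>: "ideal_smult A (h ` I) V <+>\<^bsub>V\<^esub> \<theta> ` carrier M = ideal_smult A (h ` I) V"
proof -
  have "\<theta> ` carrier M \<subseteq> ideal_smult A (h ` I) V"
    using h_in_span[OF c_mem] by (auto simp: h_c_eq)
  then show ?thesis
    using V.submodule_set_add_least[OF span_h_submodule subset_refl]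
      V.submodule_set_add_upper(1)[OF span_h_submodule image_\<theta>_submodule] by blast
qed

lemma image_span_h: "\<phi> ` ideal_smult A (h ` I) V = ideal_smult R I M"
proof
  define P where "P = {x \<in> carrier M. \<phi> x \<in> ideal_smult R I M}"
  have "submodule P R M"
    unfolding P_def using linear_map_vimage_submodule[OF module_axioms module_axioms \<phi>_linear]
      ideal_smult_submodule[OF I_carrier] by blast
  then have "submodule P A V"
    using bicommutant_commutes linear_maps_closed[OF bicommutant_linear]
      linear_map_ideal_smult[OF bicommutant_linear I_carrier]
    by (intro submodule_evaluation_moduleI[OF bicommutant_subcring]) (auto simp: P_def)
  then have "ideal_smult A (h ` I) V \<subseteq> P"
    by (rule ideal_smult_least) (auto simp: P_def h_closed \<phi>_h ideal_smultI)
  then show "\<phi> ` ideal_smult A (h ` I) V \<subseteq> ideal_smult R I M" by (auto simp: P_def)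
  show "ideal_smult R I M \<subseteq> \<phi> ` ideal_smult A (h ` I) V"
  proof (rule ideal_smult_least)
    show "submodule (\<phi> ` ideal_smult A (h ` I) V) R M"
      by (rule linear_map_image_submodule[OF module_axioms module_axioms \<phi>_linear
            submodule_if_submodule_over_A[OF span_h_submodule]])
    show "a \<odot>\<^bsub>M\<^esub> x \<in> \<phi> ` ideal_smult A (h ` I) V" if "a \<in> I" "x \<in> carrier M" for a x
      using h_in_span[OF that] \<phi>_h[OF that] by (metis imageI)
  qed
qed

lemma residual_image_\<theta>: "residual_submodule V (\<theta> ` carrier M) (h ` I) = residual_submodule M cM I"
proof -
  have "h a x \<in> \<theta> ` carrier M \<longleftrightarrow> a \<odot>\<^bsub>M\<^esub> x \<in> cM" if "a \<in> I" "x \<in> carrier M" for a x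
  proof -
    have "h a x \<in> \<theta> ` carrier M \<longleftrightarrow> (\<exists>y\<in>carrier M. \<phi> (h a x) = \<phi> (\<theta> y))"
      using that by (auto simp: \<phi>_eq_iff h_closed \<theta>_simps(1))
    then show ?thesis using that by (auto simp: \<phi>_h \<phi>_\<theta>)
  qed
  then show ?thesis by (auto simp: residual_submodule_def)
qed

lemma finite_length_image_\<theta>:
  assumes "finite_length R M cM (carrier M)"
  shows "finite_length A V (\<theta> ` carrier M) (carrier V)"
proof -
  have "cM \<subseteq> \<theta> ` carrier M" using \<phi>_simps(1) by (auto simp: \<theta>_\<phi>[symmetric])
  then show ?thesis
    using submodule_if_submodule_over_A
    by (intro finite_length_subset[OF assms]) (auto simp: submodules_between_def)
qed

lemma image_eq_ideal_smult_iff_residual_le: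
  assumes "finite_length R M cM (carrier M)"
  shows "\<phi> ` carrier M = ideal_smult R I M \<longleftrightarrow> residual_submodule M cM I \<subseteq> \<theta> ` carrier M"
proof -
  have "\<phi> ` carrier M = ideal_smult R I M \<longleftrightarrow> ideal_smult A (h ` I) V = carrier V"
    unfolding image_span_h[symmetric]
    using inj_on_image_eq_iff[OF inj_\<phi> subset_refl V.submoduleE(1)[OF span_h_submodule, simplified]]
    by auto
  also have "\<dots> \<longleftrightarrow> residual_submodule V (\<theta> ` carrier M) (h ` I) \<subseteq> \<theta> ` carrier M"
    using V.smult_surjective_iff_injective[OF finite_length_image_\<theta>[OF assms] image_\<theta>_submodule, of "h ` I"]
      h_mem by (simp add: span_h_add_image_\<theta> image_subset_iff)
  finally show ?thesis unfolding residual_image_\<theta> .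
qed

end

context scalar_factorization
begin

lemma ex_scalar_quotients:
  assumes "ideal_smult R I M \<subseteq> \<phi> ` carrier M"
  shows "\<exists>h. scalar_quotients R M I c \<phi> \<theta> h"
proof -
  have "\<exists>h. h \<in> bicommutant \<and> (\<forall>x\<in>carrier M. \<phi> (h x) = a \<odot>\<^bsub>M\<^esub> x)" if a: "a \<in> I" for a
  proof -
    have aR: "a \<in> carrier R" using a I_carrier by blast
    have "(\<lambda>x\<in>carrier M. a \<odot>\<^bsub>M\<^esub> x) ` carrier M \<subseteq> \<phi> ` carrier M"
      using assms ideal_smultI[OF a, of _ M R] by auto
    then obtain h where "h \<in> linear_maps R M M"
      and "\<And>x. x \<in> carrier M \<Longrightarrow> \<phi> (h x) = (\<lambda>x\<in>carrier M. a \<odot>\<^bsub>M\<^esub> x) x"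
      using linear_map_lift[OF module_axioms module_axioms \<phi>_linear inj_\<phi> smult_linear[OF aR]] by blast
    then show ?thesis using scalar_quotient_in_bicommutant[OF _ aR] by auto
  qed
  then obtain h where "\<And>a. a \<in> I \<Longrightarrow> h a \<in> bicommutant \<and> (\<forall>x\<in>carrier M. \<phi> (h a x) = a \<odot>\<^bsub>M\<^esub> x)"
    by metis
  then have "scalar_quotients R M I c \<phi> \<theta> h" by unfold_locales auto
  then show ?thesis by blast
qed

theorem image_eq_ideal_smult_iff:
  assumes "finite_length R M cM (carrier M)"
  shows "\<phi> ` carrier M = ideal_smult R I M \<longleftrightarrow> \<theta> ` carrier M = residual_submodule M cM I"
proof (cases "ideal_smult R I M \<subseteq> \<phi> ` carrier M")
  case True
  then obtain h where "scalar_quotients R M I c \<phi> \<theta> h" using ex_scalar_quotients by blast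
  then have "\<phi> ` carrier M = ideal_smult R I M \<longleftrightarrow> residual_submodule M cM I \<subseteq> \<theta> ` carrier M"
    using assms by (rule scalar_quotients.image_eq_ideal_smult_iff_residual_le)
  also have "\<dots> \<longleftrightarrow> \<theta> ` carrier M = residual_submodule M cM I"
    using True ideal_smult_le_image_iff by (metis subset_antisym subset_refl)
  finally show ?thesis .
next
  case False
  then show ?thesis using ideal_smult_le_image_iff by (metis subset_refl)
qed

end

lemma (in module) ex_cofactor:
  assumes c: "c \<in> carrier R" "inj_on ((\<odot>\<^bsub>M\<^esub>) c) (carrier M)"
    and f: "f \<in> linear_maps R M M" "inj_on f (carrier M)"
    and sub: "(\<odot>\<^bsub>M\<^esub>) c ` carrier M \<subseteq> f ` carrier M"
  obtains g where "g \<in> linear_maps R M M" "inj_on g (carrier M)"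
    and "\<And>x. x \<in> carrier M \<Longrightarrow> f (g x) = c \<odot>\<^bsub>M\<^esub> x" "\<And>x. x \<in> carrier M \<Longrightarrow> g (f x) = c \<odot>\<^bsub>M\<^esub> x"
proof -
  have "(\<lambda>x\<in>carrier M. c \<odot>\<^bsub>M\<^esub> x) ` carrier M \<subseteq> f ` carrier M" using sub by auto
  then obtain g where g: "g \<in> linear_maps R M M"
    and "\<And>x. x \<in> carrier M \<Longrightarrow> f (g x) = (\<lambda>x\<in>carrier M. c \<odot>\<^bsub>M\<^esub> x) x"
    using linear_map_lift[OF module_axioms module_axioms f smult_linear[OF c(1)]] by blast
  then have fg: "f (g x) = c \<odot>\<^bsub>M\<^esub> x" if "x \<in> carrier M" for x using that by simp
  show thesis
  proof (rule that[OF g _ fg])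
    show "inj_on g (carrier M)" using c(2) fg by (metis (mono_tags, lifting) inj_on_def)
    show "g (f x) = c \<odot>\<^bsub>M\<^esub> x" if "x \<in> carrier M" for x
      by (rule inj_onD[OF f(2)])
        (use that c(1) in \<open>simp_all add: fg linear_maps_smult[OF f(1)] linear_maps_closed[OF f(1)]
          linear_maps_closed[OF g]\<close>)
  qed
qed

theorem (in module) ex_image_ideal_smult_iff_ex_image_residual:
  fixes c
  assumes I: "ideal I R" and c: "c \<in> I" "inj_on ((\<odot>\<^bsub>M\<^esub>) c) (carrier M)"
  defines "cM \<equiv> (\<odot>\<^bsub>M\<^esub>) c ` carrier M"
  assumes fin: "finite_length R M cM (carrier M)"
  shows "(\<exists>\<phi>\<in>linear_maps R M M. inj_on \<phi> (carrier M) \<and> \<phi> ` carrier M = ideal_smult R I M) \<longleftrightarrow>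
    (\<exists>\<theta>\<in>linear_maps R M M. inj_on \<theta> (carrier M) \<and> \<theta> ` carrier M = residual_submodule M cM I)"
    (is "?ideal_smult \<longleftrightarrow> ?residual")
proof -
  have cR: "c \<in> carrier R" using ideal.Icarr[OF I c(1)] .
  have iff: "f ` carrier M = ideal_smult R I M \<longleftrightarrow> g ` carrier M = residual_submodule M cM I"
    if "f \<in> linear_maps R M M" "g \<in> linear_maps R M M"
      "\<And>x. x \<in> carrier M \<Longrightarrow> f (g x) = c \<odot>\<^bsub>M\<^esub> x" "\<And>x. x \<in> carrier M \<Longrightarrow> g (f x) = c \<odot>\<^bsub>M\<^esub> x" for f g
  proof -
    interpret scalar_factorization R M I c f g
      by (intro scalar_factorization.intro scalar_factorization_axioms.intro module_axioms I c that)
    show ?thesis unfolding cM_def by (rule image_eq_ideal_smult_iff[OF fin[unfolded cM_def]])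
  qed
  show ?thesis
  proof
    assume ?ideal_smult
    then obtain \<phi> where \<phi>: "\<phi> \<in> linear_maps R M M" "inj_on \<phi> (carrier M)" "\<phi> ` carrier M = ideal_smult R I M"
      by blast
    have "(\<odot>\<^bsub>M\<^esub>) c ` carrier M \<subseteq> \<phi> ` carrier M" using ideal_smultI[OF c(1)] by (auto simp: \<phi>(3))
    then show ?residual using ex_cofactor[OF cR c(2) \<phi>(1,2)] iff[OF \<phi>(1)] \<phi>(3) by metis
  next
    assume ?residual
    then obtain \<theta> where \<theta>: "\<theta> \<in> linear_maps R M M" "inj_on \<theta> (carrier M)"
      "\<theta> ` carrier M = residual_submodule M cM I" by blast
    have "cM \<subseteq> residual_submodule M cM I"
      using ideal.Icarr[OF I] cR by (auto simp: residual_submodule_def cM_def smult_left_commute[of _ c])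
    then show ?ideal_smult using ex_cofactor[OF cR c(2) \<theta>(1,2)] iff[OF _ \<theta>(1)] \<theta>(3) cM_def by metis
  qed
qed


section \<open>Isomorphisms\<close>

lemma modules_isomorphic_sym:
  assumes M: "module R M" and N: "module R N" and "modules_isomorphic R M N"
  shows "modules_isomorphic R N M"
proof -
  interpret N: module R N by fact
  obtain f where f: "f \<in> linear_maps R M N" and bij: "bij_betw f (carrier M) (carrier N)"
    using assms(3) unfolding modules_isomorphic_def by blast
  have "(\<lambda>x\<in>carrier N. x) \<in> linear_maps R N N" by (rule linear_mapsI) auto
  moreover have "(\<lambda>x\<in>carrier N. x) ` carrier N \<subseteq> f ` carrier M"
    using bij by (simp add: bij_betw_def)
  ultimately obtain g where g: "g \<in> linear_maps R N M" "\<And>x. x \<in> carrier N \<Longrightarrow> f (g x) = (\<lambda>x\<in>carrier N. x) x"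
    using linear_map_lift[OF M N f bij_betw_imp_inj_on[OF bij]] by blast
  have "g (f x) = x" if "x \<in> carrier M" for x
    using that g linear_maps_closed[OF f] linear_maps_closed[OF g(1)]
    by (intro inj_onD[OF bij_betw_imp_inj_on[OF bij]]) auto
  then have "bij_betw g (carrier N) (carrier M)"
    using g linear_maps_closed[OF f] linear_maps_closed[OF g(1)]
    by (intro bij_betw_byWitness[of _ f]) auto
  with g(1) show ?thesis unfolding modules_isomorphic_def by blast
qed

lemma modules_isomorphic_trans:
  assumes "module R M" "modules_isomorphic R M N" "modules_isomorphic R N P"
  shows "modules_isomorphic R M P"
  using assms linear_maps_compose bij_betw_compose unfolding modules_isomorphic_def by meson

lemma modules_isomorphic_submodule_iff:
  assumes "submodule U R N"
  shows "modules_isomorphic R M (N\<lparr>carrier := U\<rparr>) \<longleftrightarrow>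
    (\<exists>f\<in>linear_maps R M N. inj_on f (carrier M) \<and> f ` carrier M = U)"
proof -
  have "U \<subseteq> carrier N" using subgroup.subset[OF submodule.axioms(1)[OF assms]] by simp
  then have "f \<in> linear_maps R M (N\<lparr>carrier := U\<rparr>) \<longleftrightarrow> f \<in> linear_maps R M N" if "f ` carrier M = U" for f
    using that by (auto simp: linear_maps_def PiE_iff)
  then show ?thesis unfolding modules_isomorphic_def bij_betw_def by auto
qed

lemma (in module) linear_maps_ideal_commute:
  assumes I: "ideal I R" and g: "g \<in> linear_maps R ((ring_as_module R)\<lparr>carrier := I\<rparr>) M"
    and a: "a \<in> I" and b: "b \<in> I"
  shows "b \<odot>\<^bsub>M\<^esub> g a = a \<odot>\<^bsub>M\<^esub> g b"
proof -
  have carr: "r \<in> carrier R" if "r \<in> I" for r using ideal.Icarr[OF I that] .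
  have "s \<odot>\<^bsub>M\<^esub> g t = g (s \<otimes> t)" if "s \<in> I" "t \<in> I" for s t
    using linear_maps_smult[OF g, of s t] that carr by (simp add: ring_as_module_def)
  then show ?thesis using a b carr by (simp add: R.m_comm)
qed

lemma (in module) ex_linear_map_of_residual:
  assumes I: "ideal I R" and c: "c \<in> I" "inj_on ((\<odot>\<^bsub>M\<^esub>) c) (carrier M)"
    and y: "y \<in> residual_submodule M ((\<odot>\<^bsub>M\<^esub>) c ` carrier M) I"
  obtains g where "g \<in> linear_maps R ((ring_as_module R)\<lparr>carrier := I\<rparr>) M" "g c = y"
proof -
  let ?I = "(ring_as_module R)\<lparr>carrier := I\<rparr>"
  have cR: "c \<in> carrier R" using ideal.Icarr[OF I c(1)] .
  have yM: "y \<in> carrier M" and Iy: "\<And>a. a \<in> I \<Longrightarrow> a \<odot>\<^bsub>M\<^esub> y \<in> (\<odot>\<^bsub>M\<^esub>) c ` carrier M"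
    using y by (auto simp: residual_submodule_def)
  have "inj_on (\<lambda>x\<in>carrier M. c \<odot>\<^bsub>M\<^esub> x) (carrier M)" using c(2) by (simp add: inj_on_def)
  moreover have "(\<lambda>a\<in>I. a \<odot>\<^bsub>M\<^esub> y) ` carrier ?I \<subseteq> (\<lambda>x\<in>carrier M. c \<odot>\<^bsub>M\<^esub> x) ` carrier M"
    using Iy by auto
  ultimately obtain g where g: "g \<in> linear_maps R ?I M"
    and lift: "\<And>a. a \<in> carrier ?I \<Longrightarrow> (\<lambda>x\<in>carrier M. c \<odot>\<^bsub>M\<^esub> x) (g a) = (\<lambda>a\<in>I. a \<odot>\<^bsub>M\<^esub> y) a"
    using linear_map_lift[OF module_axioms R.ideal_as_module_module[OF I] smult_linear[OF cR] _
        smult_element_linear[OF I yM]] by blast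
  have gc: "g c \<in> carrier M" using linear_maps_closed[OF g] c(1) by simp
  then have "c \<odot>\<^bsub>M\<^esub> g c = c \<odot>\<^bsub>M\<^esub> y" using lift[of c] c(1) by simp
  then have "g c = y" using gc yM by (rule inj_onD[OF c(2)])
  with g show thesis by (rule that)
qed

lemma (in module) bij_betw_evaluation_residual:
  assumes I: "ideal I R" and c: "c \<in> I" "inj_on ((\<odot>\<^bsub>M\<^esub>) c) (carrier M)"
  shows "bij_betw (\<lambda>g. g c) (linear_maps R ((ring_as_module R)\<lparr>carrier := I\<rparr>) M)
    (residual_submodule M ((\<odot>\<^bsub>M\<^esub>) c ` carrier M) I)"
proof -
  let ?I = "(ring_as_module R)\<lparr>carrier := I\<rparr>"
  have closed: "g a \<in> carrier M" if "g \<in> linear_maps R ?I M" "a \<in> I" for g a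
    using linear_maps_closed[OF that(1), of a] that(2) by simp
  show ?thesis
  proof (intro bij_betw_imageI inj_onI equalityI subsetI)
    fix g g' assume g: "g \<in> linear_maps R ?I M" "g' \<in> linear_maps R ?I M" "g c = g' c"
    show "g = g'"
    proof (rule linear_maps_ext[OF g(1,2)])
      fix a assume "a \<in> carrier ?I"
      then have a: "a \<in> I" by simp
      then have "c \<odot>\<^bsub>M\<^esub> g a = c \<odot>\<^bsub>M\<^esub> g' a"
        using g(3) linear_maps_ideal_commute[OF I g(1) a c(1)] linear_maps_ideal_commute[OF I g(2) a c(1)]
        by simp
      then show "g a = g' a" by (rule inj_onD[OF c(2)]) (use closed g(1,2) a in auto)
    qed
  next
    fix y assume "y \<in> (\<lambda>g. g c) ` linear_maps R ?I M"
    then obtain g where g: "g \<in> linear_maps R ?I M" "y = g c" by blast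
    have "a \<odot>\<^bsub>M\<^esub> y \<in> (\<odot>\<^bsub>M\<^esub>) c ` carrier M" if "a \<in> I" for a
      using linear_maps_ideal_commute[OF I g(1) that c(1)] closed[OF g(1) that] g(2) by (metis imageI)
    then show "y \<in> residual_submodule M ((\<odot>\<^bsub>M\<^esub>) c ` carrier M) I"
      using closed[OF g(1) c(1)] g(2) by (simp add: residual_submodule_def)
  next
    fix y assume "y \<in> residual_submodule M ((\<odot>\<^bsub>M\<^esub>) c ` carrier M) I"
    then show "y \<in> (\<lambda>g. g c) ` linear_maps R ?I M"
      using ex_linear_map_of_residual[OF assms] by (metis imageI)
  qed
qed

lemma (in module) Hom_ideal_isomorphic_residual:
  assumes I: "ideal I R" and c: "c \<in> I" "inj_on ((\<odot>\<^bsub>M\<^esub>) c) (carrier M)"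
  shows "modules_isomorphic R (Hom_module R ((ring_as_module R)\<lparr>carrier := I\<rparr>) M)
    (M\<lparr>carrier := residual_submodule M ((\<odot>\<^bsub>M\<^esub>) c ` carrier M) I\<rparr>)"
proof -
  let ?H = "Hom_module R ((ring_as_module R)\<lparr>carrier := I\<rparr>) M"
  let ?C = "residual_submodule M ((\<odot>\<^bsub>M\<^esub>) c ` carrier M) I"
  interpret Hom: module R ?H
    by (rule Hom_module_module[OF R.ideal_as_module_module[OF I] module_axioms])
  define ev where "ev = (\<lambda>g\<in>carrier ?H. g c)"
  have "bij_betw ev (carrier ?H) ?C"
    using bij_betw_evaluation_residual[OF assms] by (simp add: ev_def bij_betw_restrict_eq Hom_module_def)
  moreover from this have "ev \<in> linear_maps R ?H (M\<lparr>carrier := ?C\<rparr>)"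
    using Hom.a_closed Hom.smult_closed c(1) bij_betwE
    by (intro linear_mapsI) (fastforce simp: ev_def Hom_module_def)+
  ultimately show ?thesis unfolding modules_isomorphic_def by auto
qed

theorem (in module) ideal_smult_isomorphic_iff_isomorphic_Hom:
  assumes I: "ideal I R" and c: "c \<in> I" "inj_on ((\<odot>\<^bsub>M\<^esub>) c) (carrier M)"
    and fin: "finite_length R M ((\<odot>\<^bsub>M\<^esub>) c ` carrier M) (carrier M)"
  shows "modules_isomorphic R (M\<lparr>carrier := ideal_smult R I M\<rparr>) M \<longleftrightarrow>
    modules_isomorphic R M (Hom_module R ((ring_as_module R)\<lparr>carrier := I\<rparr>) M)"
    (is "_ \<longleftrightarrow> modules_isomorphic R M ?H")
proof -
  define C where "C = residual_submodule M ((\<odot>\<^bsub>M\<^esub>) c ` carrier M) I"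
  have I_carrier: "I \<subseteq> carrier R" using ideal.Icarr[OF I] by blast
  then have IM: "submodule (ideal_smult R I M) R M" by (rule ideal_smult_submodule)
  have C: "submodule C R M"
    unfolding C_def using c(1) I_carrier by (intro residual_submodule_submodule smult_image_submodule) auto
  note modules = module_axioms ideal_smult_module[OF I] submodule.submodule_is_module[OF C module_axioms]
    Hom_module_module[OF R.ideal_as_module_module[OF I] module_axioms]
  have Hom: "modules_isomorphic R ?H (M\<lparr>carrier := C\<rparr>)"
    unfolding C_def by (rule Hom_ideal_isomorphic_residual[OF I c])
  have "modules_isomorphic R (M\<lparr>carrier := ideal_smult R I M\<rparr>) M \<longleftrightarrow>
      modules_isomorphic R M (M\<lparr>carrier := ideal_smult R I M\<rparr>)"
    using modules(1,2) by (blast intro: modules_isomorphic_sym)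
  also have "\<dots> \<longleftrightarrow> modules_isomorphic R M (M\<lparr>carrier := C\<rparr>)"
    unfolding modules_isomorphic_submodule_iff[OF IM] modules_isomorphic_submodule_iff[OF C]
    unfolding C_def by (rule ex_image_ideal_smult_iff_ex_image_residual[OF I c fin])
  also have "\<dots> \<longleftrightarrow> modules_isomorphic R M ?H"
    using modules_isomorphic_trans[OF modules(1) _ Hom]
      modules_isomorphic_trans[OF modules(1) _ modules_isomorphic_sym[OF modules(4,3) Hom]] by blast
  finally show ?thesis .
qed

section \<open>Noetherian local rings of dimension one\<close>

lemma (in ring) ex_ideal_maximal_avoiding:
  assumes J: "ideal J R" and disjoint: "J \<inter> S = {}"
  obtains P where "ideal P R" "J \<subseteq> P" "P \<inter> S = {}"
    and "\<And>Q. ideal Q R \<Longrightarrow> P \<subseteq> Q \<Longrightarrow> Q \<inter> S = {} \<Longrightarrow> Q = P"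
proof -
  define F where "F = {Q. ideal Q R \<and> J \<subseteq> Q \<and> Q \<inter> S = {}}"
  have "\<Union>C \<in> F" if C: "C \<noteq> {}" "subset.chain F C" for C
  proof -
    have sub: "C \<subseteq> F" using C(2) by (simp add: pred_on.chain_def)
    then have "subset.chain {Q. ideal Q R} C" using C(2) by (auto simp: pred_on.chain_def F_def)
    then have "ideal (\<Union>C) R" using chain_Union_is_ideal[of C] C(1) by simp
    then show ?thesis using sub C(1) by (auto simp: F_def)
  qed
  moreover have "F \<noteq> {}" using J disjoint by (auto simp: F_def)
  ultimately obtain P where "P \<in> F" "\<forall>Q\<in>F. P \<subseteq> Q \<longrightarrow> Q = P" using subset_Zorn_nonempty[of F] by blast
  then show thesis by (intro that) (auto simp: F_def)
qed

lemma local_ring_proper_ideal: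
  assumes "local_ring R \<mm>" "ideal J R" "J \<noteq> carrier R"
  shows "J \<subseteq> \<mm>"
proof -
  interpret ideal J R by fact
  have "J \<inter> {\<one>\<^bsub>R\<^esub>} = {}" using one_imp_carrier assms(3) by auto
  then obtain P where P: "ideal P R" "J \<subseteq> P" "P \<inter> {\<one>\<^bsub>R\<^esub>} = {}"
    and max: "\<And>Q. ideal Q R \<Longrightarrow> P \<subseteq> Q \<Longrightarrow> Q \<inter> {\<one>\<^bsub>R\<^esub>} = {} \<Longrightarrow> Q = P"
    using ex_ideal_maximal_avoiding[OF assms(2)] by metis
  have "maximalideal P R"
  proof (rule maximalidealI[OF P(1)])
    show "carrier R \<noteq> P" using P(3) by auto
    show "Q = P \<or> Q = carrier R" if "ideal Q R" "P \<subseteq> Q" "Q \<subseteq> carrier R" for Q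
      using max[OF that(1,2)] ideal.one_imp_carrier[OF that(1)] by auto
  qed
  with assms(1) P(2) show ?thesis unfolding local_ring_def by blast
qed

lemma local_ring_maximalideal:
  assumes "local_ring R \<mm>"
  shows "maximalideal \<mm> R"
  using assms unfolding local_ring_def by blast

lemma local_ring_unit:
  assumes "local_ring R \<mm>" "r \<in> carrier R" "r \<notin> \<mm>"
  shows "\<exists>s\<in>carrier R. s \<otimes>\<^bsub>R\<^esub> r = \<one>\<^bsub>R\<^esub>"
proof -
  interpret cring R using assms(1) by (simp add: local_ring_def)
  have "PIdl\<^bsub>R\<^esub> r = carrier R"
    using local_ring_proper_ideal[OF assms(1) cgenideal_ideal[OF assms(2)]]
      cgenideal_self[OF assms(2)] assms(3) by blast
  then have "\<one>\<^bsub>R\<^esub> \<in> PIdl\<^bsub>R\<^esub> r" by simp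
  then show ?thesis unfolding cgenideal_def by force
qed

lemma (in cring) primeideal_if_maximal_avoiding:
  assumes P: "ideal P R" "P \<inter> S = {}"
    and max: "\<And>Q. ideal Q R \<Longrightarrow> P \<subseteq> Q \<Longrightarrow> Q \<inter> S = {} \<Longrightarrow> Q = P"
    and S: "S \<subseteq> carrier R" "\<one> \<in> S" "\<And>s t. s \<in> S \<Longrightarrow> t \<in> S \<Longrightarrow> s \<otimes> t \<in> S"
  shows "primeideal P R"
proof (rule primeidealI[OF P(1) cring_axioms])
  interpret P: ideal P R by fact
  have meets: "\<exists>p\<in>P. \<exists>r\<in>carrier R. p \<oplus> r \<otimes> a \<in> S" if a: "a \<in> carrier R" "a \<notin> P" for a
  proof -
    let ?Q = "P <+>\<^bsub>R\<^esub> PIdl a"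
    interpret A: ideal "PIdl a" R by (rule cgenideal_ideal[OF a(1)])
    have "ideal ?Q R" by (rule add_ideals[OF P(1) A.ideal_axioms])
    moreover have "P \<subseteq> ?Q" using set_addI[OF _ A.zero_closed, of _ P R] P.Icarr by force
    moreover have "a \<in> ?Q"
      using set_addI[OF P.zero_closed cgenideal_self[OF a(1)], of R] a(1) by simp
    ultimately have "?Q \<inter> S \<noteq> {}" using max a(2) by blast
    then show ?thesis unfolding set_add_def' cgenideal_def by auto
  qed
  show "carrier R \<noteq> P" using P(2) S(1,2) by blast
  fix a b assume ab: "a \<in> carrier R" "b \<in> carrier R" "a \<otimes> b \<in> P"
  show "a \<in> P \<or> b \<in> P"
  proof (rule ccontr)
    assume "\<not> (a \<in> P \<or> b \<in> P)"
    then obtain p r q s where pr: "p \<in> P" "r \<in> carrier R" "p \<oplus> r \<otimes> a \<in> S"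
      and qs: "q \<in> P" "s \<in> carrier R" "q \<oplus> s \<otimes> b \<in> S"
      using meets ab by meson
    have "(p \<oplus> r \<otimes> a) \<otimes> (q \<oplus> s \<otimes> b)
        = p \<otimes> (q \<oplus> s \<otimes> b) \<oplus> ((r \<otimes> a) \<otimes> q \<oplus> (r \<otimes> s) \<otimes> (a \<otimes> b))"
      using ab(1,2) pr(2) qs(2) P.Icarr[OF pr(1)] P.Icarr[OF qs(1)] by algebra
    also have "\<dots> \<in> P"
      using ab pr(1,2) qs(1,2) by (simp add: P.I_l_closed P.I_r_closed P.Icarr)
    finally show False using S(3)[OF pr(3) qs(3)] P(2) by blast
  qed
qed

lemma (in cring) ex_primeideal_avoiding:
  assumes "ideal J R" "J \<inter> S = {}"
    and "S \<subseteq> carrier R" "\<one> \<in> S" "\<And>s t. s \<in> S \<Longrightarrow> t \<in> S \<Longrightarrow> s \<otimes> t \<in> S"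
  obtains P where "primeideal P R" "J \<subseteq> P" "P \<inter> S = {}"
  using ex_ideal_maximal_avoiding[OF assms(1,2)] primeideal_if_maximal_avoiding[OF _ _ _ assms(3-5)] by metis

lemma krull_dim_ge_two:
  assumes "primeideal P R" "primeideal Q R" "primeideal T R" "P \<subset> Q" "Q \<subset> T"
  shows "krull_dim R \<ge> 2"
proof -
  define C where "C i = (if i = 0 then P else if i = 1 then Q else T)" for i :: nat
  have "(\<forall>i\<le>2. primeideal (C i) R) \<and> (\<forall>i<2. C i \<subset> C (Suc i))"
    using assms by (auto simp: C_def less_2_cases_iff)
  then have "enat 2 \<le> krull_dim R"
    unfolding krull_dim_def by (intro Sup_upper) blast
  then show ?thesis by (simp add: numeral_eq_enat)
qed

lemma (in module) inj_on_smult_iff: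
  assumes "c \<in> carrier R"
  shows "inj_on ((\<odot>\<^bsub>M\<^esub>) c) (carrier M) \<longleftrightarrow> (\<forall>x\<in>carrier M. c \<odot>\<^bsub>M\<^esub> x = \<zero>\<^bsub>M\<^esub> \<longrightarrow> x = \<zero>\<^bsub>M\<^esub>)"
proof
  assume inj: "inj_on ((\<odot>\<^bsub>M\<^esub>) c) (carrier M)"
  show "\<forall>x\<in>carrier M. c \<odot>\<^bsub>M\<^esub> x = \<zero>\<^bsub>M\<^esub> \<longrightarrow> x = \<zero>\<^bsub>M\<^esub>"
    using inj_onD[OF inj, of _ "\<zero>\<^bsub>M\<^esub>"] assms by simp
next
  assume ker: "\<forall>x\<in>carrier M. c \<odot>\<^bsub>M\<^esub> x = \<zero>\<^bsub>M\<^esub> \<longrightarrow> x = \<zero>\<^bsub>M\<^esub>"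
  show "inj_on ((\<odot>\<^bsub>M\<^esub>) c) (carrier M)"
  proof (rule inj_onI)
    fix x y assume xy: "x \<in> carrier M" "y \<in> carrier M" "c \<odot>\<^bsub>M\<^esub> x = c \<odot>\<^bsub>M\<^esub> y"
    then have "c \<odot>\<^bsub>M\<^esub> (x \<ominus>\<^bsub>M\<^esub> y) = \<zero>\<^bsub>M\<^esub>"
      using assms by (simp add: a_minus_def smult_r_distr smult_r_minus M.r_neg)
    then have "x \<ominus>\<^bsub>M\<^esub> y = y \<ominus>\<^bsub>M\<^esub> y" using ker xy(1,2) by (simp add: a_minus_def M.r_neg)
    then show "x = y" using xy(1,2) by (simp add: a_minus_def)
  qed
qed

lemma (in module) inj_on_smult_nat_pow:
  assumes "c \<in> carrier R" "inj_on ((\<odot>\<^bsub>M\<^esub>) c) (carrier M)"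
  shows "inj_on ((\<odot>\<^bsub>M\<^esub>) (c [^] (k :: nat))) (carrier M)"
proof (induction k)
  case 0
  show ?case by (auto intro: inj_onI)
next
  case (Suc k)
  show ?case
  proof (rule inj_onI)
    fix x y assume xy: "x \<in> carrier M" "y \<in> carrier M"
      and "c [^] Suc k \<odot>\<^bsub>M\<^esub> x = c [^] Suc k \<odot>\<^bsub>M\<^esub> y"
    then have "c [^] k \<odot>\<^bsub>M\<^esub> (c \<odot>\<^bsub>M\<^esub> x) = c [^] k \<odot>\<^bsub>M\<^esub> (c \<odot>\<^bsub>M\<^esub> y)"
      using assms(1) by (simp add: smult_assoc1)
    then have "c \<odot>\<^bsub>M\<^esub> x = c \<odot>\<^bsub>M\<^esub> y" by (rule inj_onD[OF Suc.IH]) (use xy assms(1) in simp_all)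
    then show "x = y" using xy by (rule inj_onD[OF assms(2)])
  qed
qed

lemma (in module) annihilates_if_regular_pow_mult_eq_zero:
  assumes c: "c \<in> carrier R" "inj_on ((\<odot>\<^bsub>M\<^esub>) c) (carrier M)"
    and s: "s \<in> carrier R" and zero: "c [^] (k :: nat) \<otimes> s = \<zero>" and x: "x \<in> carrier M"
  shows "s \<odot>\<^bsub>M\<^esub> x = \<zero>\<^bsub>M\<^esub>"
proof -
  have "c [^] k \<odot>\<^bsub>M\<^esub> (s \<odot>\<^bsub>M\<^esub> x) = \<zero>\<^bsub>M\<^esub>"
    using zero s x c(1) by (simp add: smult_assoc1[symmetric])
  then show ?thesis
    using inj_on_smult_nat_pow[OF c, of k] s x c(1) by (simp add: inj_on_smult_iff)
qed

lemma (in module) ex_primeideal_avoiding_regular: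
  assumes P: "primeideal P R" and ann: "residual_ideal R M {\<zero>\<^bsub>M\<^esub>} (carrier M) \<subseteq> P"
    and c: "c \<in> carrier R" "inj_on ((\<odot>\<^bsub>M\<^esub>) c) (carrier M)"
  obtains P' where "primeideal P' R" "P' \<subseteq> P" "c \<notin> P'"
proof -
  interpret P: primeideal P R by fact
  have one: "\<one> \<notin> P" using P.one_imp_carrier P.I_notcarr by blast
  define S where "S = {c [^] k \<otimes> s | (k :: nat) s. s \<in> carrier R - P}"
  have SI: "c [^] k \<otimes> s \<in> S" if "s \<in> carrier R" "s \<notin> P" for k :: nat and s
    using that by (auto simp: S_def)
  obtain P' where P': "primeideal P' R" "P' \<inter> S = {}"
  proof (rule R.ex_primeideal_avoiding[OF R.zeroideal])
    show "S \<subseteq> carrier R" using c(1) by (auto simp: S_def)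
    show "\<one> \<in> S" using SI[of \<one> 0] one by simp
    show "s \<otimes> t \<in> S" if st: "s \<in> S" "t \<in> S" for s t
    proof -
      obtain k s' l t' where factors: "s = c [^] (k :: nat) \<otimes> s'" "t = c [^] (l :: nat) \<otimes> t'"
        "s' \<in> carrier R - P" "t' \<in> carrier R - P" using st by (auto simp: S_def)
      then have "s \<otimes> t = c [^] (k + l) \<otimes> (s' \<otimes> t')"
        using c(1) by (simp add: R.nat_pow_mult[symmetric] R.m_ac)
      with SI[of "s' \<otimes> t'"] factors P.I_prime[of s' t'] show ?thesis by auto
    qed
    have "s \<in> P" if "s \<in> carrier R" "c [^] k \<otimes> s = \<zero>" for k :: nat and s
      using annihilates_if_regular_pow_mult_eq_zero[OF c that] that(1) ann by (auto simp: residual_ideal_def)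
    then show "{\<zero>} \<inter> S = {}" by (auto simp: S_def)
  qed
  interpret P': primeideal P' R by fact
  show thesis
  proof (rule that[OF P'(1)])
    have "s \<in> S" if "s \<in> carrier R" "s \<notin> P" for s using SI[OF that, of 0] that(1) by simp
    then show "P' \<subseteq> P" using P'(2) P'.Icarr by blast
    show "c \<notin> P'" using SI[of \<one> 1] one P'(2) c(1) by auto
  qed
qed

lemma (in module) primeideal_regular_eq_maximal:
  assumes loc: "local_ring R \<mm>" and dim: "krull_dim R \<le> 1"
    and P: "primeideal P R" and ann: "residual_ideal R M {\<zero>\<^bsub>M\<^esub>} (carrier M) \<subseteq> P"
    and c: "c \<in> P" "inj_on ((\<odot>\<^bsub>M\<^esub>) c) (carrier M)"
  shows "P = \<mm>"
proof (rule ccontr)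
  assume "P \<noteq> \<mm>"
  interpret P: primeideal P R by fact
  have "P \<subseteq> \<mm>" using local_ring_proper_ideal[OF loc P.ideal_axioms] P.I_notcarr by simp
  with \<open>P \<noteq> \<mm>\<close> have "P \<subset> \<mm>" by blast
  obtain P' where P': "primeideal P' R" "P' \<subseteq> P" "c \<notin> P'"
    using ex_primeideal_avoiding_regular[OF P ann P.Icarr[OF c(1)] c(2)] by blast
  then have "P' \<subset> P" using c(1) by blast
  then have "krull_dim R \<ge> 2"
    using \<open>P \<subset> \<mm>\<close>
    by (rule krull_dim_ge_two[OF P'(1) P R.maximalideal_prime[OF local_ring_maximalideal[OF loc]]])
  then have "(2 :: enat) \<le> 1" using dim by (rule order_trans)
  then show False by simp
qed

lemma (in module) maximal_ideal_nilpotent_mod_regular: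
  assumes loc: "local_ring R \<mm>" and dim: "krull_dim R \<le> 1"
    and c: "c \<in> carrier R" "inj_on ((\<odot>\<^bsub>M\<^esub>) c) (carrier M)" and a: "a \<in> \<mm>"
  shows "\<exists>k :: nat. \<forall>x\<in>carrier M. a [^] k \<odot>\<^bsub>M\<^esub> x \<in> (\<odot>\<^bsub>M\<^esub>) c ` carrier M"
proof (rule ccontr)
  assume neg: "\<not> ?thesis"
  interpret m: maximalideal \<mm> R by (rule local_ring_maximalideal[OF loc])
  have aR: "a \<in> carrier R" using a by (rule m.Icarr)
  define J where "J = residual_ideal R M ((\<odot>\<^bsub>M\<^esub>) c ` carrier M) (carrier M)"
  have J: "ideal J R"
    unfolding J_def by (rule residual_ideal_ideal[OF smult_image_submodule[OF c(1)]]) simp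
  obtain P where P: "primeideal P R" "J \<subseteq> P" "P \<inter> range (\<lambda>k :: nat. a [^] k) = {}"
  proof (rule R.ex_primeideal_avoiding[OF J])
    show "range (\<lambda>k :: nat. a [^] k) \<subseteq> carrier R" using aR by auto
    show "\<one> \<in> range (\<lambda>k :: nat. a [^] k)" by (rule range_eqI[of _ _ 0]) simp
    show "s \<otimes> t \<in> range (\<lambda>k :: nat. a [^] k)"
      if "s \<in> range (\<lambda>k :: nat. a [^] k)" "t \<in> range (\<lambda>k :: nat. a [^] k)" for s t
      using that R.nat_pow_mult[OF aR] by auto
    show "J \<inter> range (\<lambda>k :: nat. a [^] k) = {}"
      using neg aR by (auto simp: J_def residual_ideal_def)
  qed
  have "c \<in> P" using P(2) c(1) by (auto simp: J_def residual_ideal_def)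
  moreover have "\<zero>\<^bsub>M\<^esub> \<in> (\<odot>\<^bsub>M\<^esub>) c ` carrier M"
    by (rule submodule_zero[OF smult_image_submodule[OF c(1)]])
  then have "residual_ideal R M {\<zero>\<^bsub>M\<^esub>} (carrier M) \<subseteq> P"
    using P(2) by (auto simp: J_def residual_ideal_def)
  ultimately have "P = \<mm>" using primeideal_regular_eq_maximal[OF loc dim P(1) _ _ c(2)] by blast
  then have "a [^] (1 :: nat) \<in> P" using a aR by simp
  with P(3) show False by blast
qed

lemma (in noetherian_ring) ex_maximal_ideal_in_family:
  assumes "B \<noteq> {}" "\<And>b. b \<in> B \<Longrightarrow> ideal (J b) R"
  obtains b where "b \<in> B" "\<And>b'. b' \<in> B \<Longrightarrow> J b \<subseteq> J b' \<Longrightarrow> J b' = J b"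
proof -
  have "\<Union>C \<in> J ` B" if C: "C \<noteq> {}" "subset.chain (J ` B) C" for C
  proof -
    have sub: "C \<subseteq> J ` B" using C(2) by (simp add: pred_on.chain_def)
    then have "subset.chain {I. ideal I R} C"
      using C(2) assms(2) by (auto simp: pred_on.chain_def)
    with sub show ?thesis using ideal_chain_is_trivial[OF C(1)] by blast
  qed
  then have "\<exists>I\<in>J ` B. \<forall>I'\<in>J ` B. I \<subseteq> I' \<longrightarrow> I' = I"
    using assms(1) by (intro subset_Zorn_nonempty) auto
  then obtain b where "b \<in> B" "\<forall>I'\<in>J ` B. J b \<subseteq> I' \<longrightarrow> I' = J b" by blast
  then show thesis by (intro that) auto
qed

lemma (in module) nat_pow_smult_notin:
  assumes a: "a \<in> carrier R" and x: "x \<in> carrier M" "x \<notin> Q"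
    and le: "residual_ideal R M Q {a \<odot>\<^bsub>M\<^esub> x} \<subseteq> residual_ideal R M Q {x}"
  shows "a [^] (k :: nat) \<odot>\<^bsub>M\<^esub> x \<notin> Q"
proof (induction k)
  case 0
  show ?case using x by simp
next
  case (Suc k)
  then have "a [^] k \<notin> residual_ideal R M Q {a \<odot>\<^bsub>M\<^esub> x}"
    using le by (auto simp: residual_ideal_def)
  then show ?case using a x(1) by (simp add: residual_ideal_def smult_assoc1)
qed

lemma (in module) ex_socle_multiple:
  assumes noeth: "noetherian_ring R" and A: "A \<subseteq> carrier R" and Q: "submodule Q R M"
    and e: "e \<in> carrier M" "e \<notin> Q" and nilpotent: "\<And>a. a \<in> A \<Longrightarrow> \<exists>k :: nat. a [^] k \<odot>\<^bsub>M\<^esub> e \<in> Q"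
  obtains b where "b \<in> carrier R" "b \<odot>\<^bsub>M\<^esub> e \<notin> Q" "\<And>a. a \<in> A \<Longrightarrow> a \<odot>\<^bsub>M\<^esub> (b \<odot>\<^bsub>M\<^esub> e) \<in> Q"
proof -
  define ann where "ann b = residual_ideal R M Q {b \<odot>\<^bsub>M\<^esub> e}" for b
  define B where "B = {b \<in> carrier R. b \<odot>\<^bsub>M\<^esub> e \<notin> Q}"
  have "\<one> \<in> B" using e by (simp add: B_def)
  then have "B \<noteq> {}" by blast
  moreover have "ideal (ann b) R" if "b \<in> B" for b
    unfolding ann_def using that e by (intro residual_ideal_ideal Q) (auto simp: B_def)
  ultimately obtain b where b: "b \<in> B" and max: "\<And>b'. b' \<in> B \<Longrightarrow> ann b \<subseteq> ann b' \<Longrightarrow> ann b' = ann b"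
    using noetherian_ring.ex_maximal_ideal_in_family[OF noeth, of B ann] by metis
  have bR: "b \<in> carrier R" and be: "b \<odot>\<^bsub>M\<^esub> e \<notin> Q" using b by (auto simp: B_def)
  have "a \<odot>\<^bsub>M\<^esub> (b \<odot>\<^bsub>M\<^esub> e) \<in> Q" if a: "a \<in> A" for a
  proof (rule ccontr)
    assume notin: "a \<odot>\<^bsub>M\<^esub> (b \<odot>\<^bsub>M\<^esub> e) \<notin> Q"
    have aR: "a \<in> carrier R" using a A by blast
    have "a \<otimes> b \<in> B" using notin aR bR e by (simp add: B_def smult_assoc1)
    moreover have "ann b \<subseteq> ann (a \<otimes> b)"
      using submoduleE(4)[OF Q aR] aR bR e
      by (auto simp: ann_def residual_ideal_def smult_assoc1 smult_left_commute[of _ a])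
    ultimately have "ann (a \<otimes> b) = ann b" by (rule max)
    then have "a [^] k \<odot>\<^bsub>M\<^esub> (b \<odot>\<^bsub>M\<^esub> e) \<notin> Q" for k :: nat
      using aR bR be e by (intro nat_pow_smult_notin) (simp_all add: ann_def smult_assoc1)
    moreover obtain k :: nat where "a [^] k \<odot>\<^bsub>M\<^esub> e \<in> Q" using nilpotent[OF a] by blast
    then have "a [^] k \<odot>\<^bsub>M\<^esub> (b \<odot>\<^bsub>M\<^esub> e) \<in> Q"
      using submoduleE(4)[OF Q bR] aR bR e by (simp add: smult_left_commute[of _ b])
    ultimately show False by blast
  qed
  with bR be show thesis by (rule that)
qed

lemma (in module) submodules_between_add_cyclic:
  assumes loc: "local_ring R \<mm>" and Q: "submodule Q R M" and e: "e \<in> carrier M"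
    and me: "\<And>a. a \<in> \<mm> \<Longrightarrow> a \<odot>\<^bsub>M\<^esub> e \<in> Q"
  shows "submodules_between R M Q (Q <+>\<^bsub>M\<^esub> cyclic_submodule R M e)
    \<subseteq> {Q, Q <+>\<^bsub>M\<^esub> cyclic_submodule R M e}"
proof
  fix U assume U_between: "U \<in> submodules_between R M Q (Q <+>\<^bsub>M\<^esub> cyclic_submodule R M e)"
  then have U: "submodule U R M" "Q \<subseteq> U" "U \<subseteq> Q <+>\<^bsub>M\<^esub> cyclic_submodule R M e"
    by (auto simp: submodules_between_def)
  show "U \<in> {Q, Q <+>\<^bsub>M\<^esub> cyclic_submodule R M e}"
  proof (cases "U = Q")
    case False
    then obtain x where x: "x \<in> U" "x \<notin> Q" using U(2) by blast
    then have "x \<in> Q <+>\<^bsub>M\<^esub> cyclic_submodule R M e" using U(3) by blast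
    then obtain q r where qr: "q \<in> Q" "r \<in> carrier R" "x = q \<oplus>\<^bsub>M\<^esub> r \<odot>\<^bsub>M\<^esub> e"
      unfolding set_add_def' cyclic_submodule_def by blast
    have carr: "q \<in> carrier M" using qr(1) submoduleE(1)[OF Q] by blast
    have "r \<notin> \<mm>" using me[of r] submoduleE(5)[OF Q qr(1)] qr(3) x(2) by blast
    then obtain s where s: "s \<in> carrier R" "s \<otimes> r = \<one>" using local_ring_unit[OF loc qr(2)] by blast
    have "r \<odot>\<^bsub>M\<^esub> e = x \<ominus>\<^bsub>M\<^esub> q"
      using qr carr e by (simp add: a_minus_def M.a_ac M.r_neg M.r_neg1 M.r_neg2)
    then have "r \<odot>\<^bsub>M\<^esub> e \<in> U" using submodule_minus[OF U(1) x(1)] qr(1) U(2) by auto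
    then have "s \<odot>\<^bsub>M\<^esub> (r \<odot>\<^bsub>M\<^esub> e) \<in> U" using s(1) by (rule submoduleE(4)[OF U(1), rotated])
    then have "e \<in> U" using s qr(2) e by (simp add: smult_assoc1[symmetric])
    then have "Q <+>\<^bsub>M\<^esub> cyclic_submodule R M e \<subseteq> U"
      by (intro submodule_set_add_least[OF U(1,2)] cyclic_submodule_least[OF U(1)])
    with U(3) show ?thesis by blast
  qed simp
qed

lemma (in module) ex_simple_extension_by_multiple:
  assumes noeth: "noetherian_ring R" and loc: "local_ring R \<mm>" and P: "submodule P R M"
    and e: "e \<in> carrier M" "e \<notin> P" and nilpotent: "\<And>a. a \<in> \<mm> \<Longrightarrow> \<exists>k :: nat. a [^] k \<odot>\<^bsub>M\<^esub> e \<in> P"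
  obtains P' b where "submodule P' R M" "P \<subseteq> P'" "finite_length R M P P'"
    and "b \<in> carrier R" "b \<odot>\<^bsub>M\<^esub> e \<in> P'" "b \<odot>\<^bsub>M\<^esub> e \<notin> P"
proof -
  interpret m: maximalideal \<mm> R by (rule local_ring_maximalideal[OF loc])
  obtain b where b: "b \<in> carrier R" "b \<odot>\<^bsub>M\<^esub> e \<notin> P"
    and socle: "\<And>a. a \<in> \<mm> \<Longrightarrow> a \<odot>\<^bsub>M\<^esub> (b \<odot>\<^bsub>M\<^esub> e) \<in> P"
    using ex_socle_multiple[OF noeth m.a_subset P e nilpotent] by metis
  have be: "b \<odot>\<^bsub>M\<^esub> e \<in> carrier M" using b(1) e(1) by simp
  note E = cyclic_submodule_submodule[OF be]
  show thesis
  proof (rule that[OF submodule_set_add[OF P E] submodule_set_add_upper(1)[OF P E] _ b(1) _ b(2)])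
    show "finite_length R M P (P <+>\<^bsub>M\<^esub> cyclic_submodule R M (b \<odot>\<^bsub>M\<^esub> e))"
      by (rule finite_length_if_simple[OF submodules_between_add_cyclic[OF loc P be socle]])
    show "b \<odot>\<^bsub>M\<^esub> e \<in> P <+>\<^bsub>M\<^esub> cyclic_submodule R M (b \<odot>\<^bsub>M\<^esub> e)"
      using submodule_set_add_upper(2)[OF P E] cyclic_submodule_self[OF be] by blast
  qed
qed

lemma (in module) ex_finite_length_extension:
  assumes noeth: "noetherian_ring R" and loc: "local_ring R \<mm>" and Q: "submodule Q R M"
    and e: "e \<in> carrier M" and nilpotent: "\<And>a. a \<in> \<mm> \<Longrightarrow> \<exists>k :: nat. a [^] k \<odot>\<^bsub>M\<^esub> e \<in> Q"
  obtains P where "submodule P R M" "Q \<subseteq> P" "e \<in> P" "finite_length R M Q P"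
proof -
  define ann where "ann P = residual_ideal R M P {e}" for P
  define F where "F = {P. submodule P R M \<and> Q \<subseteq> P \<and> finite_length R M Q P}"
  have "F \<noteq> {}" using Q finite_length_refl by (auto simp: F_def)
  moreover have "ideal (ann P) R" if "P \<in> F" for P
    unfolding ann_def using that e by (intro residual_ideal_ideal) (auto simp: F_def)
  ultimately obtain P where PF: "P \<in> F" and max: "\<And>P'. P' \<in> F \<Longrightarrow> ann P \<subseteq> ann P' \<Longrightarrow> ann P' = ann P"
    using noetherian_ring.ex_maximal_ideal_in_family[OF noeth, of F ann] by metis
  have P: "submodule P R M" "Q \<subseteq> P" "finite_length R M Q P" using PF by (auto simp: F_def)
  have "e \<in> P"
  proof (rule ccontr)
    assume "e \<notin> P"
    moreover have "\<exists>k :: nat. a [^] k \<odot>\<^bsub>M\<^esub> e \<in> P" if "a \<in> \<mm>" for a using nilpotent[OF that] P(2) by blast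
    ultimately obtain P' b where P': "submodule P' R M" "P \<subseteq> P'" "finite_length R M P P'"
      and b: "b \<in> carrier R" "b \<odot>\<^bsub>M\<^esub> e \<in> P'" "b \<odot>\<^bsub>M\<^esub> e \<notin> P"
      using ex_simple_extension_by_multiple[OF noeth loc P(1) e] by metis
    have "finite_length R M Q P'"
      by (rule finite_length_trans[OF P(3) P'(3) P(1) P'(1) P(2) P'(2)])
    then have "P' \<in> F" using P(2) P'(1,2) by (auto simp: F_def)
    moreover have "ann P \<subseteq> ann P'" using P'(2) by (auto simp: ann_def residual_ideal_def)
    ultimately have "ann P' = ann P" by (rule max)
    moreover have "b \<in> ann P'" "b \<notin> ann P" using b by (auto simp: ann_def residual_ideal_def)
    ultimately show False by blast
  qed
  with P show thesis by (intro that)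
qed

lemma (in module) finite_length_if_nilpotent:
  assumes noeth: "noetherian_ring R" and loc: "local_ring R \<mm>" and fg: "finitely_generated_module R M"
    and K: "submodule K R M"
    and nilpotent: "\<And>a x. a \<in> \<mm> \<Longrightarrow> x \<in> carrier M \<Longrightarrow> \<exists>k :: nat. a [^] k \<odot>\<^bsub>M\<^esub> x \<in> K"
  shows "finite_length R M K (carrier M)"
proof -
  obtain A where A: "finite A" "A \<subseteq> carrier M" "carrier M = submodule_span R M A"
    using fg unfolding finitely_generated_module_def by blast
  have "\<exists>Q. submodule Q R M \<and> K \<subseteq> Q \<and> A \<subseteq> Q \<and> finite_length R M K Q"
    using A(1,2)
  proof (induction A rule: finite_induct)
    case empty
    show ?case using K finite_length_refl by blast
  next
    case (insert e A)
    then obtain Q where Q: "submodule Q R M" "K \<subseteq> Q" "A \<subseteq> Q" "finite_length R M K Q" by auto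
    have "\<exists>k :: nat. a [^] k \<odot>\<^bsub>M\<^esub> e \<in> Q" if "a \<in> \<mm>" for a
      using nilpotent[OF that] insert.prems Q(2) by blast
    then obtain P where P: "submodule P R M" "Q \<subseteq> P" "e \<in> P" "finite_length R M Q P"
      using ex_finite_length_extension[OF noeth loc Q(1)] insert.prems by (metis insert_subset)
    have "finite_length R M K P" by (rule finite_length_trans[OF Q(4) P(4) Q(1) P(1) Q(2) P(2)])
    with P(1-3) Q(2,3) show ?case by blast
  qed
  then obtain Q where Q: "submodule Q R M" "A \<subseteq> Q" "finite_length R M K Q" by blast
  have "carrier M \<subseteq> Q" using A(3) Q(1,2) by (auto simp: submodule_span_def)
  with Q(3) show ?thesis by (rule finite_length_mono[OF _ subset_refl])
qed

lemma (in module) finite_length_mod_regular: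
  assumes noeth: "noetherian_ring R" and loc: "local_ring R \<mm>" and dim: "krull_dim R \<le> 1"
    and fg: "finitely_generated_module R M"
    and c: "c \<in> carrier R" "inj_on ((\<odot>\<^bsub>M\<^esub>) c) (carrier M)"
  shows "finite_length R M ((\<odot>\<^bsub>M\<^esub>) c ` carrier M) (carrier M)"
  using maximal_ideal_nilpotent_mod_regular[OF loc dim c]
  by (intro finite_length_if_nilpotent[OF noeth loc fg smult_image_submodule[OF c(1)]]) blast

section \<open>Maximal Cohen-Macaulay modules\<close>

lemma (in module) ideal_smult_genideal_empty: "ideal_smult R (Idl {}) M = {\<zero>\<^bsub>M\<^esub>}"
proof
  have "submodule {\<zero>\<^bsub>M\<^esub>} R M" by (rule submoduleI) auto
  moreover have "Idl {} \<subseteq> {\<zero>}" by (rule R.genideal_minimal[OF R.zeroideal]) simp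
  ultimately show "ideal_smult R (Idl {}) M \<subseteq> {\<zero>\<^bsub>M\<^esub>}" by (intro ideal_smult_least) auto
  have "Idl {} \<subseteq> carrier R" using ideal.Icarr[OF R.genideal_ideal] by blast
  then show "{\<zero>\<^bsub>M\<^esub>} \<subseteq> ideal_smult R (Idl {}) M"
    using submodule_zero[OF ideal_smult_submodule] by blast
qed

lemma (in module) ex_regular_if_depth_pos:
  assumes "ideal_smult R \<mm> M \<noteq> carrier M" "depth R \<mm> M > 0"
  shows "\<exists>x\<in>\<mm> \<inter> carrier R. inj_on ((\<odot>\<^bsub>M\<^esub>) x) (carrier M)"
proof -
  define D where "D = {enat (length xs) | xs. set xs \<subseteq> \<mm> \<and> regular_sequence R M xs}"
  have "Sup D > 0" using assms by (simp add: depth_def D_def split: if_splits)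
  then obtain xs where xs: "set xs \<subseteq> \<mm>" "regular_sequence R M xs" "0 < length xs"
    by (auto simp: less_Sup_iff D_def zero_enat_def)
  have "xs ! 0 \<in> \<mm> \<inter> carrier R"
    using xs nth_mem[OF xs(3)] by (auto simp: regular_sequence_def)
  moreover have "\<forall>y\<in>carrier M. xs ! 0 \<odot>\<^bsub>M\<^esub> y \<in> ideal_smult R (Idl (set (take 0 xs))) M \<longrightarrow>
      y \<in> ideal_smult R (Idl (set (take 0 xs))) M"
    using xs(2,3) unfolding regular_sequence_def by blast
  then have "\<forall>y\<in>carrier M. xs ! 0 \<odot>\<^bsub>M\<^esub> y = \<zero>\<^bsub>M\<^esub> \<longrightarrow> y = \<zero>\<^bsub>M\<^esub>"
    by (simp add: ideal_smult_genideal_empty)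
  ultimately show ?thesis by (auto simp: inj_on_smult_iff)
qed

lemma maximal_cohen_macaulay_ex_regular:
  assumes loc: "local_ring R \<mm>" and MCM: "maximal_cohen_macaulay R \<mm> M"
    and dim: "0 < krull_dim R" "krull_dim R < \<infinity>"
  obtains x where "x \<in> \<mm>" "x \<in> carrier R" "inj_on ((\<odot>\<^bsub>M\<^esub>) x) (carrier M)"
proof (cases "carrier M = {\<zero>\<^bsub>M\<^esub>}")
  case True
  interpret m: maximalideal \<mm> R by (rule local_ring_maximalideal[OF loc])
  have "\<zero>\<^bsub>R\<^esub> \<in> \<mm>" by (rule additive_subgroup.zero_closed[OF m.additive_subgroup_axioms])
  then show thesis by (rule that[OF _ m.zero_closed]) (simp add: True)
next
  case False
  interpret module R M using MCM by (simp add: maximal_cohen_macaulay_def)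
  have depth: "depth R \<mm> M = krull_dim R" using False MCM by (simp add: maximal_cohen_macaulay_def)
  then have "ideal_smult R \<mm> M \<noteq> carrier M" using dim(2) by (auto simp: depth_def)
  moreover have "depth R \<mm> M > 0" using depth dim(1) by simp
  ultimately show thesis using ex_regular_if_depth_pos that by blast
qed

theorem lemma3p8:
  fixes R :: "('a, 'c) ring_scheme" and \<mm> I :: "'a set"
    and M :: "('a, 'b, 'd) module_scheme"
  assumes "cohen_macaulay_local_ring R \<mm>"
    and "krull_dim R = 1"
    and "maximal_cohen_macaulay R \<mm> M"
    and "primary_to R \<mm> I"
  shows "modules_isomorphic R (M\<lparr>carrier := ideal_smult R I M\<rparr>) M \<longleftrightarrow>
         modules_isomorphic R M (Hom_module R ((ring_as_module R)\<lparr>carrier := I\<rparr>) M)"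
proof -
  have noeth: "noetherian_ring R" and loc: "local_ring R \<mm>"
    using assms(1) by (simp_all add: cohen_macaulay_local_ring_def)
  have M: "module R M" and fg: "finitely_generated_module R M"
    using assms(3) by (simp_all add: maximal_cohen_macaulay_def)
  interpret module R M by (rule M)
  have I: "ideal I R" and rad: "radical R I = \<mm>"
    using assms(4) by (simp_all add: primary_to_def primary_ideal_def)
  obtain x where x: "x \<in> \<mm>" "x \<in> carrier R" "inj_on ((\<odot>\<^bsub>M\<^esub>) x) (carrier M)"
    using maximal_cohen_macaulay_ex_regular[OF loc assms(3)] assms(2) by auto
  then obtain k :: nat where "x [^]\<^bsub>R\<^esub> k \<in> I" using rad by (auto simp: radical_def)
  then obtain c where c: "c \<in> I" "c \<in> carrier R" "inj_on ((\<odot>\<^bsub>M\<^esub>) c) (carrier M)"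
    using inj_on_smult_nat_pow[OF x(2,3)] x(2) by blast
  have "finite_length R M ((\<odot>\<^bsub>M\<^esub>) c ` carrier M) (carrier M)"
    by (rule finite_length_mod_regular[OF noeth loc _ fg c(2,3)]) (simp add: assms(2))
  then show ?thesis by (rule ideal_smult_isomorphic_iff_isomorphic_Hom[OF I c(1,3)])
qed

end
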